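(* Let $f=(\mathsf{x}(f),\mathsf{y}(f),\mathsf{t}(f))$ and $g=(\mathsf{x}(g),\mathsf{y}(g),\mathsf{t}(g))$ be harmonic curves on a domain $\Omega\subset\mathbb{R}^n$ corresponding to the same given $C^3$ function $H$ and such that $f,g\in C^0(\overline\Omega)$. Suppose that $H$ satisfies, on the range of $\mathsf{y}(f)$, $$H'''H'\big(1+(H')^2\big)+(H'')^2\big(1-(H')^2\big)\le0 .$$ If $\mathsf{y}(f)\le\mathsf{y}(g)$ on $\partial\Omega$, then $\mathsf{y}(f)\le\mathsf{y}(g)$ in $\Omega$. Moreover, if $H$ is additionally non-increasing, then also $\mathsf{x}(f)\le\mathsf{x}(g)$ on $\partial\Omega$ implies $\mathsf{x}(f)\le\mathsf{x}(g)$ in $\Omega$.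
   Context: The first Heisenberg group $\mathbb{H}^1$ is $\mathbb{R}^3$ with coordinates $(\mathsf{x},\mathsf{y},\mathsf{t})$ and contact form $\theta=d\mathsf{t}+2(\mathsf{x}\,d\mathsf{y}-\mathsf{y}\,d\mathsf{x})$. Let $\Omega\subset\mathbb{R}^n$ be a domain. A harmonic curve (also called $C^2$-harmonic mapping) is a $C^2$ map $f=(\mathsf{x},\mathsf{y},\mathsf{t}):\Omega\to\mathbb{H}^1$ (components also written $\mathsf{x}(f),\mathsf{y}(f),\mathsf{t}(f)$), also written $f=(\mathsf{z},\mathsf{t})$ with $\mathsf{z}=\mathsf{x}+i\mathsf{y}$, such that: (1) (isotropicity) $\frac{\partial\mathsf{x}}{\partial x_\alpha}\frac{\partial\mathsf{y}}{\partial x_\beta}-\frac{\partial\mathsf{x}}{\partial x_\beta}\frac{\partial\mathsf{y}}{\partial x_\alpha}=0$ for all $\alpha<\beta$, and the contact condition $f^*\theta=0$ holds, i.e. $\nabla\mathsf{t}=2(\mathsf{y}\nabla\mathsf{x}-\mathsf{x}\nabla\mathsf{y})$; (2) (criticality) $\mathsf{z}$ is a critical point of $E^2(f)=\int_\Omega|\nabla\mathsf{z}|^2dx$, where $|\nabla\mathsf{z}|^2=|\nabla\mathsf{x}|^2+|\nabla\mathsf{y}|^2$, with respect to domain variations $\mathsf{z}_s(x)=\mathsf{z}(x+s\xi(x))$, $\xi\in C_0^\infty(\Omega,\mathbb{R}^n)$; that is, for all $\phi\in C_0^\infty(\Omega)$ and $\gamma=1,\dots,n$, $$\int_\Omega\Big(|\nabla\mathsf{z}|^2\frac{\partial\phi}{\partial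 x_\gamma}-2\sum_{\beta=1}^n\Big(\frac{\partial\mathsf{x}}{\partial x_\beta}\frac{\partial\mathsf{x}}{\partial x_\gamma}+\frac{\partial\mathsf{y}}{\partial x_\beta}\frac{\partial\mathsf{y}}{\partial x_\gamma}\Big)\frac{\partial\phi}{\partial x_\beta}\Big)dx=0.$$ The harmonic curve corresponds to $H$ if $\mathsf{x}=H\circ\mathsf{y}$, where $H:I\to\mathbb{R}$ is a (at least $C^2$) function on an interval $I\supset\mathsf{y}(\Omega)$. For such maps, criticality is equivalent to $$\Delta\mathsf{y}=-\frac{(H''\circ\mathsf{y})(H'\circ\mathsf{y})}{1+(H'\circ\mathsf{y})^2}|\nabla\mathsf{y}|^2\quad\text{in }\Omega.$$ $f\in C^0(\overline\Omega)$ means that $f$ extends continuously to $\overline\Omega$.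
   Formalization: The domain Ω is additionally assumed bounded; for unbounded Ω the claim fails, e.g. Ω={x₁>0}, H=0, f=(0,x₁,0), g=(0,0,0), where y(f)=y(g) on ∂Ω but y(f)>y(g) in Ω. *)

theory Defs
  imports "HOL-Analysis.Analysis"
begin

definition partial :: "'n \<Rightarrow> (real^'n \<Rightarrow> 'b::real_normed_vector) \<Rightarrow> real^'n \<Rightarrow> 'b"
  where "partial i u p = frechet_derivative u (at p) (axis i 1)"

text \<open>Only used for open sets, where it is the usual class of \<open>k\<close> times continuously
  differentiable maps.\<close>

primrec Ck_on :: "nat \<Rightarrow> (real^'n) set \<Rightarrow> (real^'n \<Rightarrow> 'b::real_normed_vector) \<Rightarrow> bool"
  where
    "Ck_on 0 \<Omega> u \<longleftrightarrow> continuous_on \<Omega> u"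
  | "Ck_on (Suc k) \<Omega> u \<longleftrightarrow> (\<forall>p\<in>\<Omega>. u differentiable (at p)) \<and> (\<forall>i. Ck_on k \<Omega> (partial i u))"

definition test_function :: "(real^'n) set \<Rightarrow> (real^'n \<Rightarrow> real) \<Rightarrow> bool"
  where "test_function \<Omega> \<phi> \<longleftrightarrow> (\<forall>k. Ck_on k UNIV \<phi>) \<and>
    compact (closure {p. \<phi> p \<noteq> 0}) \<and> closure {p. \<phi> p \<noteq> 0} \<subseteq> \<Omega>"

text \<open>Functions of one variable on an interval \<open>I\<close> of positive length; at an end point that
  belongs to \<open>I\<close> the derivatives are one-sided.\<close>

definition deriv_within :: "real set \<Rightarrow> (real \<Rightarrow> real) \<Rightarrow> real \<Rightarrow> real"
  where "deriv_within I h s = vector_derivative h (at s within I)"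

definition Ck_on_interval :: "nat \<Rightarrow> real set \<Rightarrow> (real \<Rightarrow> real) \<Rightarrow> bool"
  where "Ck_on_interval k I h \<longleftrightarrow>
    (\<forall>j<k. \<forall>s\<in>I. (deriv_within I ^^ j) h differentiable (at s within I)) \<and>
    continuous_on I ((deriv_within I ^^ k) h)"

text \<open>The Heisenberg group is \<open>\<real>\<^sup>3\<close> with coordinates \<open>(x, y, t)\<close> and contact form
  \<open>dt + 2 (x dy - y dx)\<close>.\<close>

type_synonym heisenberg = "real^3"

definition X :: "('a \<Rightarrow> heisenberg) \<Rightarrow> 'a \<Rightarrow> real" where "X f p = f p $ 1"
definition Y :: "('a \<Rightarrow> heisenberg) \<Rightarrow> 'a \<Rightarrow> real" where "Y f p = f p $ 2"
definition T :: "('a \<Rightarrow> heisenberg) \<Rightarrow> 'a \<Rightarrow> real" where "T f p = f p $ 3"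

definition isotropic_on :: "(real^'n) set \<Rightarrow> (real^'n \<Rightarrow> heisenberg) \<Rightarrow> bool"
  where "isotropic_on \<Omega> f \<longleftrightarrow> (\<forall>p\<in>\<Omega>. \<forall>\<alpha> \<beta>.
    partial \<alpha> (X f) p * partial \<beta> (Y f) p - partial \<beta> (X f) p * partial \<alpha> (Y f) p = 0)"

definition contact_on :: "(real^'n) set \<Rightarrow> (real^'n \<Rightarrow> heisenberg) \<Rightarrow> bool"
  where "contact_on \<Omega> f \<longleftrightarrow> (\<forall>p\<in>\<Omega>. \<forall>\<alpha>.
    partial \<alpha> (T f) p = 2 * (Y f p * partial \<alpha> (X f) p - X f p * partial \<alpha> (Y f) p))"

definition horizontal_energy_density :: "(real^'n \<Rightarrow> heisenberg) \<Rightarrow> real^'n \<Rightarrow> real"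
  where "horizontal_energy_density f p =
    (\<Sum>\<beta>\<in>UNIV. (partial \<beta> (X f) p)\<^sup>2) + (\<Sum>\<beta>\<in>UNIV. (partial \<beta> (Y f) p)\<^sup>2)"

text \<open>Criticality of \<open>z = x + \<i> y\<close> for the energy \<open>\<integral>\<^sub>\<Omega> |\<nabla>z|\<^sup>2\<close> under domain variations
  \<open>z\<^sub>s(p) = z(p + s \<xi>(p))\<close>, in its weak form, which makes sense even if the total energy is
  infinite. For a \<open>C\<^sup>2\<close> map the integrand is continuous with compact support in \<open>\<Omega>\<close>, hence
  integrable.\<close>

definition critical_on :: "(real^'n) set \<Rightarrow> (real^'n \<Rightarrow> heisenberg) \<Rightarrow> bool"
  where "critical_on \<Omega> f \<longleftrightarrow> (\<forall>\<phi> \<gamma>. test_function \<Omega> \<phi> \<longrightarrow>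
    (LINT p:\<Omega>|lborel. horizontal_energy_density f p * partial \<gamma> \<phi> p
      - 2 * (\<Sum>\<beta>\<in>UNIV. (partial \<beta> (X f) p * partial \<gamma> (X f) p
                        + partial \<beta> (Y f) p * partial \<gamma> (Y f) p) * partial \<beta> \<phi> p)) = 0)"

definition harmonic_curve :: "(real^'n) set \<Rightarrow> (real^'n \<Rightarrow> heisenberg) \<Rightarrow> bool"
  where "harmonic_curve \<Omega> f \<longleftrightarrow>
    Ck_on 2 \<Omega> f \<and> isotropic_on \<Omega> f \<and> contact_on \<Omega> f \<and> critical_on \<Omega> f"

definition corresponds_to ::
    "(real^'n) set \<Rightarrow> (real^'n \<Rightarrow> heisenberg) \<Rightarrow> real set \<Rightarrow> (real \<Rightarrow> real) \<Rightarrow> bool"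
  where "corresponds_to \<Omega> f I H \<longleftrightarrow> Y f ` \<Omega> \<subseteq> I \<and> (\<forall>p\<in>\<Omega>. X f p = H (Y f p))"

end

theory Submission imports Defs begin

text \<open>Let \<open>G' = \<surd>(1 + (H')\<^sup>2)\<close> and \<open>\<sigma> = G \<circ> Y f\<close>. Criticality of \<open>f\<close> under domain variations says
  that the stress-energy tensor of \<open>\<sigma>\<close> is divergence free, which makes \<open>\<sigma>\<close> harmonic. Two curves
  with the same \<open>H\<close> are therefore compared by the maximum principle for the difference of their
  \<open>\<sigma>\<close>, as \<open>G\<close> is strictly increasing. The only obstruction is a boundary value at an end
  point that \<open>I\<close> does not contain, where \<open>G\<close> might be infinite. The inequality for \<open>H\<close> means
  \<open>(ln (1 + (H')\<^sup>2))'' \<le> 0\<close> on the range of \<open>Y f\<close>, so that \<open>G'\<close> is log-concave there,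
  hence bounded, and \<open>G\<close> stays finite.

  For \<open>X\<close>, log-concavity and \<open>H'(s\<^sub>0) = 0\<close> at one point give \<open>H' = 0\<close> on the whole range,
  because \<open>ln (1 + (H')\<^sup>2)\<close> lies below its tangent at \<open>s\<^sub>0\<close>, which is \<open>0\<close>. So either \<open>X f\<close> is
  constant, or \<open>H\<close> is strictly decreasing on the range and the boundary inequality for \<open>X\<close>
  reverses to one for \<open>Y\<close>.\<close>

section \<open>Calculus of \<open>C\<^sup>k\<close> maps\<close>

lemma partial_eqI:
  assumes "(u has_derivative D) (at p)"
  shows "partial i u p = D (axis i 1)"
  using frechet_derivative_at[OF assms] by (simp add: partial_def)

text \<open>Both maps have the same derivatives at \<open>p\<close>, so the choice made by
  \<open>frechet_derivative\<close> returns the same value, even at a point without a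
  derivative.\<close>

lemma partial_cong:
  assumes "open \<Omega>" "p \<in> \<Omega>" "\<And>q. q \<in> \<Omega> \<Longrightarrow> u q = v q"
  shows "partial i u p = partial i v p"
proof -
  have "(u has_derivative D) (at p) \<longleftrightarrow> (v has_derivative D) (at p)" for D
    using has_derivative_transform_within_open[OF _ assms(1,2)] assms(3) by metis
  then show ?thesis by (simp add: partial_def frechet_derivative_def)
qed

lemma Ck_on_cong:
  assumes "open \<Omega>"
  shows "(\<And>q. q \<in> \<Omega> \<Longrightarrow> u q = v q) \<Longrightarrow> Ck_on k \<Omega> u \<Longrightarrow> Ck_on k \<Omega> v"
proof (induction k arbitrary: u v)
  case 0
  then show ?case by (metis Ck_on.simps(1) continuous_on_cong)
next
  case (Suc k)
  have "v differentiable (at p)" if "p \<in> \<Omega>" for p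
    using has_derivative_transform_within_open[OF _ assms that] Suc.prems that
    unfolding differentiable_def Ck_on.simps by metis
  moreover have "Ck_on k \<Omega> (partial i v)" for i
    using Suc.IH[of "partial i u" "partial i v"] Suc.prems partial_cong[OF assms, of _ u v]
    by (auto simp: Suc.prems)
  ultimately show ?case by simp
qed

lemma Ck_on_Suc_imp: "Ck_on (Suc k) \<Omega> u \<Longrightarrow> Ck_on k \<Omega> u"
proof (induction k arbitrary: u)
  case 0
  then show ?case
    by (auto intro!: continuous_at_imp_continuous_on differentiable_imp_continuous_within)
qed auto

lemma Ck_on_le: "Ck_on m \<Omega> u \<Longrightarrow> k \<le> m \<Longrightarrow> Ck_on k \<Omega> u"
  by (induction m) (auto simp: le_Suc_eq simp del: Ck_on.simps(2) dest: Ck_on_Suc_imp)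

lemma Ck_on_subset: "Ck_on k \<Omega> u \<Longrightarrow> S \<subseteq> \<Omega> \<Longrightarrow> Ck_on k S u"
  by (induction k arbitrary: u) (auto intro: continuous_on_subset)

lemma partial_const [simp]: "partial i (\<lambda>p. c) = (\<lambda>p. 0)"
  by (simp add: fun_eq_iff partial_eqI[OF has_derivative_const])

lemma Ck_on_const: "Ck_on k \<Omega> (\<lambda>p. c)"
  by (induction k arbitrary: c) simp_all

lemma partial_add:
  assumes "u differentiable (at p)" "v differentiable (at p)"
  shows "partial i (\<lambda>p. u p + v p) p = partial i u p + partial i v p"
  using assms unfolding frechet_derivative_works
  by (subst partial_eqI[OF has_derivative_add]) (auto simp: partial_def)

lemma partial_bounded_linear:
  assumes "bounded_linear L" "u differentiable (at p)"
  shows "partial i (\<lambda>p. L (u p)) p = L (partial i u p)"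
  using assms(2) unfolding frechet_derivative_works
  by (subst partial_eqI[OF bounded_linear.has_derivative[OF assms(1)]]) (auto simp: partial_def)

lemma partial_mult:
  fixes u v :: "real^'n \<Rightarrow> real"
  assumes "u differentiable (at p)" "v differentiable (at p)"
  shows "partial i (\<lambda>p. u p * v p) p = partial i u p * v p + u p * partial i v p"
  using assms unfolding frechet_derivative_works
  by (subst partial_eqI[OF has_derivative_mult]) (auto simp: partial_def)

lemma Ck_on_add:
  assumes "open \<Omega>"
  shows "Ck_on k \<Omega> u \<Longrightarrow> Ck_on k \<Omega> v \<Longrightarrow> Ck_on k \<Omega> (\<lambda>p. u p + v p)"
proof (induction k arbitrary: u v)
  case (Suc k)
  have "Ck_on k \<Omega> (partial i (\<lambda>p. u p + v p))" for i
  proof (rule Ck_on_cong[OF assms])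
    show "Ck_on k \<Omega> (\<lambda>p. partial i u p + partial i v p)"
      using Suc by (intro Suc.IH) auto
  qed (use Suc.prems in \<open>auto simp: partial_add\<close>)
  with Suc.prems show ?case by simp
qed (auto intro: continuous_intros)

lemma Ck_on_mult:
  fixes u v :: "real^'n \<Rightarrow> real"
  assumes "open \<Omega>"
  shows "Ck_on k \<Omega> u \<Longrightarrow> Ck_on k \<Omega> v \<Longrightarrow> Ck_on k \<Omega> (\<lambda>p. u p * v p)"
proof (induction k arbitrary: u v)
  case (Suc k)
  have *: "Ck_on k \<Omega> u" "Ck_on k \<Omega> v"
    using Suc.prems Ck_on_Suc_imp by blast+
  have "Ck_on k \<Omega> (partial i (\<lambda>p. u p * v p))" for i
  proof (rule Ck_on_cong[OF assms])
    show "Ck_on k \<Omega> (\<lambda>p. partial i u p * v p + u p * partial i v p)"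
      using Suc.prems * by (intro Ck_on_add[OF assms] Suc.IH) auto
  qed (use Suc.prems in \<open>auto simp: partial_mult\<close>)
  with Suc.prems show ?case by simp
qed (auto intro: continuous_intros)

lemma Ck_on_bounded_linear:
  assumes "open \<Omega>" "bounded_linear L"
  shows "Ck_on k \<Omega> u \<Longrightarrow> Ck_on k \<Omega> (\<lambda>p. L (u p))"
proof (induction k arbitrary: u)
  case 0
  then show ?case using bounded_linear.continuous_on[OF assms(2)] by simp
next
  case (Suc k)
  have "Ck_on k \<Omega> (partial i (\<lambda>p. L (u p)))" for i
  proof (rule Ck_on_cong[OF assms(1)])
    show "Ck_on k \<Omega> (\<lambda>p. L (partial i u p))"
      using Suc by auto
  qed (use Suc.prems in \<open>auto simp: partial_bounded_linear[OF assms(2)]\<close>)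
  moreover have "(\<lambda>p. L (u p)) differentiable (at p)" if "p \<in> \<Omega>" for p
    using Suc.prems that bounded_linear.has_derivative[OF assms(2)]
    unfolding differentiable_def Ck_on.simps by metis
  ultimately show ?case by simp
qed

lemma Ck_on_cmult:
  assumes "open \<Omega>" "Ck_on k \<Omega> u"
  shows "Ck_on k \<Omega> (\<lambda>p. c * u p :: real)"
  by (rule Ck_on_bounded_linear[OF assms(1) bounded_linear_mult_right assms(2)])

lemma Ck_on_sum:
  assumes "open \<Omega>" "\<And>j. j \<in> A \<Longrightarrow> Ck_on k \<Omega> (u j)"
  shows "Ck_on k \<Omega> (\<lambda>p. \<Sum>j\<in>A. u j p)"
  using assms(2) by (induction A rule: infinite_finite_induct)
    (auto intro!: Ck_on_const Ck_on_add[OF assms(1)] simp del: Ck_on.simps)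

lemma Ck_on_component:
  fixes \<Omega> :: "(real^'n) set"
  shows "Ck_on k \<Omega> (\<lambda>p. p $ j)"
proof (cases k)
  case (Suc m)
  have "((\<lambda>p. p $ j) has_derivative (\<lambda>h. h $ j)) (at p)" for p :: "real^'n"
    by (intro bounded_linear.has_derivative[OF bounded_linear_vec_nth] has_derivative_ident)
  then have "partial i (\<lambda>p. p $ j) = (\<lambda>p :: real^'n. axis i 1 $ j)" for i
    by (intro ext partial_eqI)
  moreover have "(\<lambda>p :: real^'n. p $ j) differentiable (at p)" for p
    unfolding differentiable_def
    using bounded_linear.has_derivative[OF bounded_linear_vec_nth has_derivative_ident] by blast
  ultimately show ?thesis using Suc by (simp add: Ck_on_const)
qed (auto intro: continuous_intros)

text \<open>Restriction to a line parallel to an axis makes the mean value theorem of one variable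
  available for partial derivatives.\<close>

lemma DERIV_along_axis:
  fixes u :: "real^'n \<Rightarrow> real"
  assumes "u differentiable (at (p + a *\<^sub>R axis i 1))"
  shows "((\<lambda>a. u (p + a *\<^sub>R axis i 1)) has_real_derivative
    partial i u (p + a *\<^sub>R axis i 1)) (at a)"
proof -
  have "((\<lambda>a. p + a *\<^sub>R axis i 1) has_derivative (\<lambda>h. h *\<^sub>R axis i 1)) (at a)"
    by (auto intro!: derivative_eq_intros)
  from diff_chain_at[OF this] assms
  have "((\<lambda>a. u (p + a *\<^sub>R axis i 1)) has_derivative
    (\<lambda>h. frechet_derivative u (at (p + a *\<^sub>R axis i 1)) (h *\<^sub>R axis i 1))) (at a)"
    unfolding frechet_derivative_works o_def by blast
  moreover have "frechet_derivative u (at (p + a *\<^sub>R axis i 1)) (h *\<^sub>R axis i 1)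
      = h * partial i u (p + a *\<^sub>R axis i 1)" for h
    using assms unfolding frechet_derivative_works partial_def
    by (metis has_derivative_bounded_linear linear_simps(5) real_scaleR_def)
  ultimately show ?thesis
    unfolding has_field_derivative_def by (simp add: mult_commute_abs)
qed

text \<open>Since \<open>u\<close> maps the open set into \<open>I\<close>, a derivative of
  \<open>h\<close> within \<open>I\<close> suffices. This covers values of \<open>u\<close> at an
  end point of \<open>I\<close>, where the derivative of \<open>h\<close> is one-sided.\<close>

lemma partial_chain:
  fixes u :: "real^'n \<Rightarrow> real"
  assumes "open \<Omega>" "u ` \<Omega> \<subseteq> I" "p \<in> \<Omega>"
    and "u differentiable (at p)" "(h has_real_derivative d) (at (u p) within I)"
  shows "(\<lambda>p. h (u p)) differentiable (at p)"
    and "partial i (\<lambda>p. h (u p)) p = d * partial i u p"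
proof -
  have h: "(h has_derivative (*) d) (at (u p) within u ` \<Omega>)"
    using assms(2,5) has_derivative_subset unfolding has_field_derivative_def by blast
  have "(u has_derivative frechet_derivative u (at p)) (at p within \<Omega>)"
    using assms(4) unfolding frechet_derivative_works by (rule has_derivative_at_withinI)
  from diff_chain_within[OF this h] have
    "((\<lambda>p. h (u p)) has_derivative (\<lambda>k. d * frechet_derivative u (at p) k)) (at p)"
    by (simp only: o_def at_within_open[OF assms(3,1)])
  then show "(\<lambda>p. h (u p)) differentiable (at p)"
    and "partial i (\<lambda>p. h (u p)) p = d * partial i u p"
    unfolding differentiable_def by (blast, subst partial_eqI, assumption, simp add: partial_def)
qed

text \<open>\<open>h j\<close> stands for the \<open>j\<close>-th derivative of one function.
  Differentiating \<open>h j\<close> after \<open>u\<close> produces \<open>h (Suc j)\<close> after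
  \<open>u\<close>, with one order of smoothness less, so the induction runs downwards from
  \<open>j = k\<close>.\<close>

lemma Ck_on_chain:
  fixes u :: "real^'n \<Rightarrow> real"
  assumes \<Omega>: "open \<Omega>" "u ` \<Omega> \<subseteq> I"
    and h: "\<And>j s. j < k \<Longrightarrow> s \<in> I \<Longrightarrow> (h j has_real_derivative h (Suc j) s) (at s within I)"
      "continuous_on I (h k)"
    and u: "Ck_on k \<Omega> u"
  shows "j \<le> k \<Longrightarrow> Ck_on (k - j) \<Omega> (\<lambda>p. h j (u p))"
proof (induction j rule: inc_induct)
  case base
  have "continuous_on \<Omega> u" using Ck_on_le[OF u, of 0] by simp
  then show ?case using continuous_on_compose2[OF h(2)] \<Omega> by simp
next
  case (step j)
  have u': "Ck_on (Suc (k - Suc j)) \<Omega> u"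
    using Ck_on_le[OF u, of "Suc (k - Suc j)"] step by simp
  have *: "(\<lambda>p. h j (u p)) differentiable (at p)"
    "partial i (\<lambda>p. h j (u p)) p = h (Suc j) (u p) * partial i u p" if "p \<in> \<Omega>" for p i
    using partial_chain[OF \<Omega> that _ h(1)] u' that \<Omega> step by auto
  have "Ck_on (k - Suc j) \<Omega> (partial i (\<lambda>p. h j (u p)))" for i
  proof (rule Ck_on_cong[OF \<Omega>(1)])
    show "Ck_on (k - Suc j) \<Omega> (\<lambda>p. h (Suc j) (u p) * partial i u p)"
      using u' by (intro Ck_on_mult[OF \<Omega>(1) step.IH]) auto
  qed (use * in auto)
  with * have "Ck_on (Suc (k - Suc j)) \<Omega> (\<lambda>p. h j (u p))" by simp
  then show ?case using step by (simp add: Suc_diff_Suc del: Ck_on.simps)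
qed

section \<open>Smooth bump functions and integration by parts\<close>

text \<open>The polynomial factor makes this family, which contains the classical flat function
  (\<open>P = 1\<close>), closed under differentiation.\<close>

definition exp_bump :: "real poly \<Rightarrow> real \<Rightarrow> real"
  where "exp_bump P t = (if t > 0 then poly P (1 / t) * exp (- (1 / t)) else 0)"

lemma tendsto_exp_bump: "(exp_bump P \<longlongrightarrow> 0) (at 0)"
proof -
  \<comment> \<open>With \<open>u = 1 / t\<close>, the limit from the right says that the
    exponential beats each monomial of \<open>P\<close>.\<close>
  have "((\<lambda>u. \<Sum>i\<le>degree P. coeff P i * (u ^ i / exp u)) \<longlongrightarrow> (\<Sum>i\<le>degree P. coeff P i * 0)) at_top"
    by (intro tendsto_sum tendsto_mult tendsto_const tendsto_power_div_exp_0)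
  then have "((\<lambda>u. poly P u * exp (- u)) \<longlongrightarrow> 0) at_top"
    by (simp add: poly_altdef exp_minus divide_inverse sum_distrib_right mult.assoc)
  from filterlim_compose[OF this filterlim_inverse_at_top_right]
  have "((\<lambda>t. poly P (1 / t) * exp (- (1 / t))) \<longlongrightarrow> 0) (at_right 0)"
    by (simp add: divide_inverse)
  then have "(exp_bump P \<longlongrightarrow> 0) (at_right 0)"
    by (rule Lim_transform_eventually)
      (auto simp: exp_bump_def eventually_at_filter)
  moreover have "(exp_bump P \<longlongrightarrow> 0) (at_left 0)"
    by (rule Lim_transform_eventually[OF tendsto_const])
      (auto simp: exp_bump_def eventually_at_filter)
  ultimately show ?thesis
    by (simp add: filterlim_at_split)
qed

text \<open>From the chain rule with \<open>u = 1 / t\<close>, whose derivative is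
  \<open>- u^2\<close>: the derivative of \<open>P(u) exp(-u)\<close> is
  \<open>u^2 (P - P')(u) exp(-u)\<close>.\<close>

definition exp_bump_deriv :: "real poly \<Rightarrow> real poly"
  where "exp_bump_deriv P = monom 1 2 * (P - pderiv P)"

lemma DERIV_exp_bump: "(exp_bump P has_real_derivative exp_bump (exp_bump_deriv P) t) (at t)"
proof (cases t "0 :: real" rule: linorder_cases)
  case less
  have "(exp_bump P has_real_derivative 0) (at t)"
    by (rule has_field_derivative_transform_within_open[where f = "\<lambda>_. 0" and S = "{..<0}"])
      (use less in \<open>auto simp: exp_bump_def\<close>)
  with less show ?thesis by (simp add: exp_bump_def)
next
  case equal
  \<comment> \<open>Dividing by \<open>h\<close> multiplies the polynomial in \<open>1 / h\<close>
    by its variable, so the difference quotient at 0 belongs to the same family and tends to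
    0.\<close>
  have "exp_bump P h / h = exp_bump (pCons 0 P) h" for h
    by (simp add: exp_bump_def)
  then have "((\<lambda>h. (exp_bump P (0 + h) - exp_bump P 0) / h) \<longlongrightarrow> 0) (at 0)"
    using tendsto_exp_bump[of "pCons 0 P"] by (simp add: exp_bump_def[of P 0])
  with equal show ?thesis
    by (simp add: DERIV_def exp_bump_def[of "exp_bump_deriv P"])
next
  case greater
  have "((\<lambda>t. poly P (1 / t) * exp (- (1 / t))) has_real_derivative
      exp_bump (exp_bump_deriv P) t) (at t)"
    using greater
    by (auto intro!: derivative_eq_intros DERIV_chain2[OF poly_DERIV]
        simp: exp_bump_def exp_bump_deriv_def poly_monom field_simps power2_eq_square)
  then show ?thesis
    by (rule has_field_derivative_transform_within_open[where S = "{0<..}"])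
      (use greater in \<open>auto simp: exp_bump_def\<close>)
qed

lemma smooth_bump:
  fixes q :: "real^'n"
  assumes "r > 0"
  obtains \<phi> :: "real^'n \<Rightarrow> real"
    where "\<forall>k. Ck_on k UNIV \<phi>" "\<forall>p. \<phi> p \<ge> 0" "\<forall>p. \<phi> p > 0 \<longleftrightarrow> p \<in> ball q r"
proof
  \<comment> \<open>The polynomial \<open>r^2 - |p - q|^2\<close>, positive exactly on the ball,
    spelled with sums and products of coordinates so that the closure rules for \<open>Ck_on\<close>
    apply.\<close>
  let ?u = "\<lambda>p. r\<^sup>2 + (\<Sum>i\<in>UNIV. - 1 * ((p $ i + - q $ i) * (p $ i + - q $ i)))"
  have u: "Ck_on k UNIV ?u" for k
    by (intro Ck_on_add Ck_on_sum Ck_on_cmult Ck_on_mult Ck_on_const Ck_on_component open_UNIV)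
  have u_eq: "?u p = r\<^sup>2 - (dist q p)\<^sup>2" for p
  proof -
    have "(dist q p)\<^sup>2 = (\<Sum>i\<in>UNIV. (q $ i - p $ i)\<^sup>2)"
      by (simp add: dist_vec_def L2_set_def sum_nonneg dist_real_def)
    also have "\<dots> = - (\<Sum>i\<in>UNIV. - 1 * ((p $ i + - q $ i) * (p $ i + - q $ i)))"
      unfolding sum_negf[symmetric] by (rule sum.cong) (auto simp: power2_eq_square algebra_simps)
    finally show ?thesis by simp
  qed
  let ?h = "\<lambda>j. exp_bump ((exp_bump_deriv ^^ j) 1)"
  show "\<forall>k. Ck_on k UNIV (\<lambda>p. ?h 0 (?u p))"
    using Ck_on_chain[where h = ?h and j = 0 and I = UNIV and u = ?u, OF open_UNIV _ _ _ u]
    by (auto simp: DERIV_exp_bump intro!: DERIV_continuous_on[OF DERIV_exp_bump])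
  show "\<forall>p. ?h 0 (?u p) \<ge> 0" by (simp add: exp_bump_def)
  have "0 < r\<^sup>2 - (dist q p)\<^sup>2 \<longleftrightarrow> dist q p < r" for p
    using power_mono_iff[of r "dist q p" 2] assms by (simp flip: not_le)
  then show "\<forall>p. ?h 0 (?u p) > 0 \<longleftrightarrow> p \<in> ball q r"
    unfolding u_eq by (simp add: exp_bump_def)
qed

section \<open>Integrals of derivatives of compactly supported functions\<close>

lemma partial_eq_0_outside:
  assumes "closed K" "\<And>p. p \<notin> K \<Longrightarrow> w p = 0" "p \<notin> K"
  shows "partial i w p = 0"
proof -
  have "partial i w p = partial i (\<lambda>_. 0) p"
    by (rule partial_cong[of "- K"]) (use assms in auto)
  then show ?thesis by simp
qed

lemma integrable_continuous_compact_support: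
  fixes w :: "'a::euclidean_space \<Rightarrow> real"
  assumes "continuous_on UNIV w" "compact K" "\<And>p. p \<notin> K \<Longrightarrow> w p = 0"
  shows "integrable lborel w"
proof -
  have "integrable lborel (\<lambda>x. indicator K x *\<^sub>R w x)"
    using borel_integrable_compact[OF assms(2) continuous_on_subset[OF assms(1)]]
    by simp
  moreover have "(\<lambda>x. indicator K x *\<^sub>R w x) = w"
    using assms(3) by (auto simp: indicator_def fun_eq_iff)
  ultimately show ?thesis by simp
qed

text \<open>By translation invariance the difference quotients of \<open>w\<close> have integral \<open>0\<close>; dominated
  convergence passes this on to the derivative.\<close>

lemma integral_partial_eq_0:
  fixes w :: "real^'n \<Rightarrow> real"
  assumes w: "Ck_on 1 UNIV w" and K: "compact K" "\<And>p. p \<notin> K \<Longrightarrow> w p = 0"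
  shows "(LINT p|lborel. partial i w p) = 0"
proof -
  define e :: "real^'n" where "e = axis i 1"
  define s where "s k = inverse (real (Suc k))" for k
  have s: "s k > 0" "s k \<le> 1" for k
    by (auto simp: s_def field_simps)
  have cont: "continuous_on UNIV w" "continuous_on UNIV (partial i w)"
    and diff: "w differentiable (at p)" for p
    using w Ck_on_Suc_imp[of 0] by auto
  have pK: "partial i w p = 0" if "p \<notin> K" for p
    using partial_eq_0_outside[where w = w, OF compact_imp_closed[OF K(1)] K(2) that] by blast
  obtain R where R: "\<And>p. p \<in> K \<Longrightarrow> norm p \<le> R"
    using K(1) compact_imp_bounded bounded_iff by metis
  obtain M where M: "\<And>p. norm (partial i w p) \<le> M"
  proof -
    have "bounded (partial i w ` K)"
      using compact_continuous_image[OF continuous_on_subset[OF cont(2)] K(1)]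
      by (auto intro: compact_imp_bounded)
    then obtain M where M: "\<And>p. p \<in> K \<Longrightarrow> norm (partial i w p) \<le> M"
      unfolding bounded_iff by blast
    have "norm (partial i w p) \<le> max M 0" for p
      using M[of p] pK[of p] by (cases "p \<in> K") auto
    with that show ?thesis by blast
  qed
  define d where "d k p = (w (p + s k *\<^sub>R e) - w p) / s k" for k p
  have int_w: "integrable lborel w"
    by (rule integrable_continuous_compact_support[OF cont(1) K])
  have shift: "integrable lborel (\<lambda>p. w (p + a))" "(LINT p|lborel. w (p + a)) = (LINT p|lborel. w p)"
    for a
  proof -
    have *: "(+) a \<in> measurable lborel borel" "w \<in> borel_measurable borel"
      using cont(1) by (auto intro: borel_measurable_continuous_onI)
    show "integrable lborel (\<lambda>p. w (p + a))"
      using int_w integrable_distr_eq[OF *] by (simp add: lborel_distr_plus add.commute)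
    show "(LINT p|lborel. w (p + a)) = (LINT p|lborel. w p)"
      using integral_distr[OF *] by (simp add: lborel_distr_plus add.commute)
  qed
  have int_d: "(LINT p|lborel. d k p) = 0" for k
    unfolding d_def using shift int_w by (simp add: integral_diff)
  \<comment> \<open>The mean value theorem bounds every quotient by \<open>M\<close>. As the steps
    \<open>s k\<close> are at most 1, the quotients vanish outside the ball of radius
    \<open>R + 1\<close>.\<close>
  have "(\<lambda>k. LINT p|lborel. d k p) \<longlonglongrightarrow> (LINT p|lborel. partial i w p)"
  proof (rule integral_dominated_convergence[where w = "\<lambda>p. indicator (cball 0 (R + 1)) p *\<^sub>R M"])
    show "partial i w \<in> borel_measurable lborel" "d k \<in> borel_measurable lborel" for k
      unfolding d_def using cont by (auto intro!: borel_measurable_continuous_onI continuous_intros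
       continuous_on_compose2[OF cont(1)] simp: s_def)
    show "integrable lborel (\<lambda>p. indicator (cball 0 (R + 1)) p *\<^sub>R M :: real)"
      by (rule borel_integrable_compact) auto
    show "AE p in lborel. (\<lambda>k. d k p) \<longlonglongrightarrow> partial i w p"
    proof (rule AE_I2)
      fix p
      have "((\<lambda>a. w (p + a *\<^sub>R e)) has_real_derivative partial i w p) (at 0)"
        using DERIV_along_axis[of w p 0 i] diff by (simp add: e_def)
      then have "((\<lambda>h. (w (p + h *\<^sub>R e) - w p) / h) \<longlongrightarrow> partial i w p) (at 0)"
        by (simp add: DERIV_def)
      moreover have "filterlim s (at 0) sequentially"
        unfolding filterlim_at using s LIMSEQ_inverse_real_of_nat
        by (auto simp: s_def[abs_def])
      ultimately show "(\<lambda>k. d k p) \<longlonglongrightarrow> partial i w p"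
        unfolding d_def by (rule filterlim_compose)
    qed
    show "AE p in lborel. norm (d k p) \<le> indicator (cball 0 (R + 1)) p *\<^sub>R M" for k
    proof (rule AE_I2)
      fix p
      have "norm (d k p) \<le> M"
      proof -
        obtain z where "w (p + s k *\<^sub>R e) - w (p + 0 *\<^sub>R e) = (s k - 0) * partial i w (p + z *\<^sub>R e)"
          using MVT2[OF s(1)[of k], of "\<lambda>a. w (p + a *\<^sub>R e)" "\<lambda>a. partial i w (p + a *\<^sub>R e)"]
            DERIV_along_axis[OF diff] unfolding e_def by blast
        then have "d k p = partial i w (p + z *\<^sub>R e)"
          using s(1)[of k] by (simp add: d_def)
        then show ?thesis using M by simp
      qed
      moreover have "d k p = 0" if "p \<notin> cball 0 (R + 1)"
      proof -
        have "norm (s k *\<^sub>R e) \<le> 1" using s[of k] by (simp add: e_def)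
        then have "norm p \<le> norm (p + s k *\<^sub>R e) + 1"
          using norm_triangle_ineq4[of "p + s k *\<^sub>R e" "s k *\<^sub>R e"] by simp
        with that R[of p] R[of "p + s k *\<^sub>R e"] have "p \<notin> K" "p + s k *\<^sub>R e \<notin> K"
          by fastforce+
        then show ?thesis by (simp add: d_def K(2))
      qed
      ultimately show "norm (d k p) \<le> indicator (cball 0 (R + 1)) p *\<^sub>R M"
        by (auto simp: indicator_def)
    qed
  qed
  with int_d show ?thesis using LIMSEQ_unique[OF _ tendsto_const] by auto
qed

lemma Ck_on_Un:
  assumes "open S" "open V"
  shows "Ck_on k S u \<Longrightarrow> Ck_on k V u \<Longrightarrow> Ck_on k (S \<union> V) u"
  by (induction k arbitrary: u) (auto intro: continuous_on_open_Un[OF assms])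

text \<open>\<open>\<Omega>\<close> and the complement of \<open>K\<close> are open and cover the
  space; on the latter the extension is 0.\<close>

lemma Ck_on_extend_0:
  assumes "open \<Omega>" "compact K" "K \<subseteq> \<Omega>" "Ck_on k \<Omega> u" "\<And>p. p \<notin> K \<Longrightarrow> u p = 0"
  shows "Ck_on k UNIV (\<lambda>p. if p \<in> \<Omega> then u p else 0)" (is "Ck_on k UNIV ?v")
proof -
  have K: "open (- K)" using assms(2) compact_imp_closed by blast
  have "Ck_on k \<Omega> ?v"
    by (rule Ck_on_cong[OF assms(1) _ assms(4)]) simp
  moreover have "Ck_on k (- K) ?v"
    by (rule Ck_on_cong[OF K _ Ck_on_const]) (use assms in auto)
  ultimately have "Ck_on k (\<Omega> \<union> - K) ?v"
    by (rule Ck_on_Un[OF assms(1) K])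
  moreover have "\<Omega> \<union> - K = UNIV" using assms(3) by blast
  ultimately show ?thesis by simp
qed

text \<open>Apply \<open>integral_partial_eq_0\<close> to each product of \<open>F \<beta>\<close>
  and \<open>\<phi>\<close>, extended by 0 because \<open>F \<beta>\<close> is controlled only in
  \<open>\<Omega>\<close>, and sum over \<open>\<beta>\<close>.\<close>

lemma integral_divergence_test_function:
  fixes F :: "'n \<Rightarrow> real^'n \<Rightarrow> real"
  assumes \<Omega>: "open \<Omega>" and F: "\<And>\<beta>. Ck_on 1 \<Omega> (F \<beta>)" and \<phi>: "test_function \<Omega> \<phi>"
  shows "(LINT p:\<Omega>|lborel. (\<Sum>\<beta>\<in>UNIV. F \<beta> p * partial \<beta> \<phi> p))
    = - (LINT p:\<Omega>|lborel. (\<Sum>\<beta>\<in>UNIV. partial \<beta> (F \<beta>) p) * \<phi> p)"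
proof -
  define K where "K = closure {p. \<phi> p \<noteq> 0}"
  have K: "compact K" "K \<subseteq> \<Omega>" and \<phi>k: "\<And>k. Ck_on k UNIV \<phi>"
    using \<phi> by (auto simp: test_function_def K_def)
  have \<phi>0: "\<phi> p = 0" if "p \<notin> K" for p
    using that closure_subset[of "{p. \<phi> p \<noteq> 0}"] by (auto simp: K_def)
  have \<phi>1: "partial \<beta> \<phi> p = 0" if "p \<notin> K" for p \<beta>
    using partial_eq_0_outside[where w = \<phi>, OF compact_imp_closed[OF K(1)] \<phi>0 that] by blast
  have F0: "Ck_on 0 \<Omega> (F \<beta>)" "Ck_on 0 \<Omega> (partial \<beta> (F \<beta>))"
    and \<phi>\<Omega>: "Ck_on k \<Omega> \<phi>" "Ck_on 0 \<Omega> (partial \<beta> \<phi>)" for \<beta> k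
    using F[of \<beta>] Ck_on_Suc_imp[of 0 \<Omega> "F \<beta>"] Ck_on_subset[OF \<phi>k subset_UNIV, of k]
      Ck_on_subset[OF \<phi>k subset_UNIV, of "Suc 0" \<Omega>] by auto
  \<comment> \<open>Extended by 0, the two terms of the product rule are continuous with compact
    support, hence integrable separately, so the integral of their sum splits.\<close>
  define a where "a \<beta> p = (if p \<in> \<Omega> then F \<beta> p * partial \<beta> \<phi> p else 0)" for \<beta> p
  define b where "b \<beta> p = (if p \<in> \<Omega> then partial \<beta> (F \<beta>) p * \<phi> p else 0)" for \<beta> p
  define w where "w \<beta> p = (if p \<in> \<Omega> then F \<beta> p * \<phi> p else 0)" for \<beta> p
  have w: "Ck_on 1 UNIV (w \<beta>)" for \<beta>
    unfolding w_def[abs_def]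
    by (intro Ck_on_extend_0[OF \<Omega> K] Ck_on_mult[OF \<Omega> F \<phi>\<Omega>(1)]) (simp add: \<phi>0)
  have "Ck_on 0 UNIV (a \<beta>)" "Ck_on 0 UNIV (b \<beta>)" for \<beta>
    unfolding a_def[abs_def] b_def[abs_def]
    by (intro Ck_on_extend_0[OF \<Omega> K] Ck_on_mult[OF \<Omega>] F0 \<phi>\<Omega>; simp add: \<phi>0 \<phi>1)+
  then have int: "integrable lborel (a \<beta>)" "integrable lborel (b \<beta>)" for \<beta>
    by (auto intro!: integrable_continuous_compact_support[OF _ K(1)] simp: a_def b_def \<phi>0 \<phi>1)
  have "partial \<beta> (w \<beta>) p = b \<beta> p + a \<beta> p" for \<beta> p
  proof (cases "p \<in> \<Omega>")
    case True
    have "partial \<beta> (w \<beta>) p = partial \<beta> (\<lambda>p. F \<beta> p * \<phi> p) p"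
      by (rule partial_cong[OF \<Omega> True]) (simp add: w_def)
    also have "\<dots> = b \<beta> p + a \<beta> p"
      using True F[of \<beta>] \<phi>k[of 1] by (simp add: partial_mult a_def b_def)
    finally show ?thesis .
  next
    case False
    then have "p \<notin> K" using K by auto
    then show ?thesis
      using False partial_eq_0_outside[OF compact_imp_closed[OF K(1)], of "w \<beta>"]
      by (simp add: a_def b_def w_def \<phi>0)
  qed
  then have "(LINT p|lborel. b \<beta> p + a \<beta> p) = 0" for \<beta>
    using integral_partial_eq_0[OF w[of \<beta>] K(1), of \<beta>] by (simp add: w_def \<phi>0)
  then have ab: "(LINT p|lborel. a \<beta> p) = - (LINT p|lborel. b \<beta> p)" for \<beta>
    using int by (simp add: add_eq_0_iff)
  have "(LINT p:\<Omega>|lborel. (\<Sum>\<beta>\<in>UNIV. F \<beta> p * partial \<beta> \<phi> p))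
      = (LINT p|lborel. (\<Sum>\<beta>\<in>UNIV. a \<beta> p))"
    unfolding set_lebesgue_integral_def
    by (rule Bochner_Integration.integral_cong) (auto simp: a_def indicator_def)
  also have "\<dots> = - (LINT p|lborel. (\<Sum>\<beta>\<in>UNIV. b \<beta> p))"
    by (simp add: int ab sum_negf)
  also have "(LINT p|lborel. (\<Sum>\<beta>\<in>UNIV. b \<beta> p))
      = (LINT p:\<Omega>|lborel. (\<Sum>\<beta>\<in>UNIV. partial \<beta> (F \<beta>) p) * \<phi> p)"
    unfolding set_lebesgue_integral_def
    by (rule Bochner_Integration.integral_cong) (auto simp: b_def indicator_def sum_distrib_right)
  finally show ?thesis .
qed

text \<open>If \<open>D q > 0\<close>, then \<open>D > 0\<close> on a ball around \<open>q\<close>,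
  and a bump function living there makes the integral positive. The other sign follows by passing to
  \<open>- D\<close>.\<close>

lemma fundamental_lemma_calculus_of_variations:
  fixes D :: "real^'n \<Rightarrow> real"
  assumes \<Omega>: "open \<Omega>" and D: "continuous_on \<Omega> D"
    and int0: "\<And>\<phi>. test_function \<Omega> \<phi> \<Longrightarrow> (LINT p:\<Omega>|lborel. D p * \<phi> p) = 0"
    and q: "q \<in> \<Omega>"
  shows "D q = 0"
proof -
  have nonpos: "E q \<le> 0" if E: "continuous_on \<Omega> E"
    and int0: "\<And>\<phi>. test_function \<Omega> \<phi> \<Longrightarrow> (LINT p:\<Omega>|lborel. E p * \<phi> p) = 0"
  for E :: "real^'n \<Rightarrow> real"
  proof (rule ccontr)
    assume "\<not> E q \<le> 0"
    then have "q \<in> {p \<in> \<Omega>. E p \<in> {0<..}}" using q by simp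
    moreover have "open {p \<in> \<Omega>. E p \<in> {0<..}}"
      using continuous_open_preimage[OF E \<Omega>, of "{0<..}"] by (simp add: vimage_def Int_def)
    ultimately obtain r where r: "r > 0" "cball q r \<subseteq> {p \<in> \<Omega>. E p \<in> {0<..}}"
      using open_contains_cball by blast
    obtain \<phi> :: "real^'n \<Rightarrow> real"
      where "\<forall>k. Ck_on k UNIV \<phi>" "\<forall>p. \<phi> p \<ge> 0" "\<forall>p. \<phi> p > 0 \<longleftrightarrow> p \<in> ball q r"
      by (rule smooth_bump[OF r(1)])
    then have \<phi>: "\<And>k. Ck_on k UNIV \<phi>" "\<And>p. \<phi> p \<ge> 0" "\<And>p. \<phi> p > 0 \<longleftrightarrow> p \<in> ball q r"
      by blast+
    have "\<phi> p \<noteq> 0 \<longleftrightarrow> p \<in> ball q r" for p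
      using \<phi>(2)[of p] \<phi>(3)[of p] by (metis order_less_le)
    then have "{p. \<phi> p \<noteq> 0} = ball q r" by blast
    then have test: "test_function \<Omega> \<phi>"
      using r \<phi>(1) by (auto simp: test_function_def)
    have \<phi>0: "\<phi> p = 0" if "p \<notin> cball q r" for p
      using that \<phi>(2,3)[of p] by force
    define w where "w p = (if p \<in> \<Omega> then E p * \<phi> p else 0)" for p
    have "Ck_on 0 UNIV w"
      unfolding w_def[abs_def]
      using Ck_on_subset[OF \<phi>(1)[of 0], of \<Omega>] E r(2)
      by (intro Ck_on_extend_0[OF \<Omega>, of "cball q r"] Ck_on_mult[OF \<Omega>]) (auto simp: \<phi>0)
    then have "integrable lborel w"
      by (intro integrable_continuous_compact_support[of w "cball q r"]) (auto simp: w_def \<phi>0)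
    moreover have w_nonneg: "w p \<ge> 0" for p
    proof (cases "p \<in> cball q r")
      case True
      then have "p \<in> \<Omega>" "E p > 0" using r(2) by auto
      then show ?thesis using \<phi>(2)[of p] by (simp add: w_def)
    qed (simp add: w_def \<phi>0)
    moreover have "(LINT p|lborel. w p) = (LINT p:\<Omega>|lborel. E p * \<phi> p)"
      unfolding set_lebesgue_integral_def
      by (rule Bochner_Integration.integral_cong) (auto simp: w_def)
    then have "(LINT p|lborel. w p) = 0" using int0[OF test] by simp
    \<comment> \<open>A nonnegative function with integral 0 vanishes almost everywhere. As
      \<open>w\<close> is positive on the ball, the ball would be a null set.\<close>
    ultimately have "AE p in lborel. w p = 0"
      using integral_nonneg_eq_0_iff_AE[of lborel w] by simp
    moreover have "w p \<noteq> 0" if "p \<in> ball q r" for p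
    proof -
      have "p \<in> cball q r" using that by auto
      then have "p \<in> \<Omega>" "E p > 0" using r(2) by auto
      then show ?thesis using \<phi>(3)[of p] that by (simp add: w_def)
    qed
    ultimately have "AE p in lborel. p \<notin> ball q r"
      by (auto elim!: eventually_mono)
    then have "ball q r \<in> null_sets lborel"
      by (subst AE_iff_null_sets) auto
    then have "negligible (ball q r)"
      by (simp add: negligible_iff_null_sets null_sets_completionI)
    then show False
      using open_not_negligible[of "ball q r"] r(1) by simp
  qed
  have "D q \<le> 0" by (rule nonpos[OF D int0])
  moreover have "- D q \<le> 0"
    by (rule nonpos[of "\<lambda>p. - D p"])
      (use D int0 in \<open>auto intro: continuous_intros simp: set_lebesgue_integral_def\<close>)
  ultimately show ?thesis by simp
qed

section \<open>Stress-energy tensor\<close>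

text \<open>Two mean value theorems, first along axis \<open>i\<close>, then along axis
  \<open>j\<close>. The difference on the left is symmetric in \<open>i\<close> and
  \<open>j\<close>, which makes the mixed derivatives comparable.\<close>

lemma second_difference:
  fixes u :: "real^'n \<Rightarrow> real"
  assumes "Ck_on 2 \<Omega> u" "ball p r \<subseteq> \<Omega>" "0 < s" "2 * s < r"
  obtains z where "dist p z \<le> 2 * s"
    "u (p + s *\<^sub>R axis i 1 + s *\<^sub>R axis j 1) - u (p + s *\<^sub>R axis i 1) - u (p + s *\<^sub>R axis j 1) + u p
      = s\<^sup>2 * partial j (partial i u) z"
proof -
  have diff: "u differentiable (at q)" "partial i u differentiable (at q)" if "dist p q < r" for q
    using assms(1,2) that by (auto simp: numeral_2_eq_2)
  \<comment> \<open>All points at which derivatives are taken have this form, so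
    \<open>2 * s < r\<close> keeps them in the ball.\<close>
  have dist: "dist p (p + a *\<^sub>R axis i 1 + b *\<^sub>R axis j 1) \<le> 2 * s"
    if "0 \<le> a" "a \<le> s" "0 \<le> b" "b \<le> s" for a b
  proof -
    have "dist p (p + a *\<^sub>R axis i 1 + b *\<^sub>R axis j 1)
        = norm (a *\<^sub>R axis i 1 + b *\<^sub>R axis j 1 :: real^'n)"
      by (subst dist_commute) (simp add: dist_norm add.assoc)
    also have "\<dots> \<le> norm (a *\<^sub>R axis i 1 :: real^'n) + norm (b *\<^sub>R axis j 1 :: real^'n)"
      by (rule norm_triangle_ineq)
    also have "\<dots> \<le> 2 * s" using that by simp
    finally show ?thesis .
  qed
  note dist' = le_less_trans[OF dist assms(4)]
  let ?\<psi> = "\<lambda>a. u (p + s *\<^sub>R axis j 1 + a *\<^sub>R axis i 1) - u (p + a *\<^sub>R axis i 1)"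
  obtain a where a: "0 < a" "a < s" "?\<psi> s - ?\<psi> 0 = (s - 0) *
      (partial i u (p + s *\<^sub>R axis j 1 + a *\<^sub>R axis i 1) - partial i u (p + a *\<^sub>R axis i 1))"
  proof -
    have "DERIV ?\<psi> a :> partial i u (p + s *\<^sub>R axis j 1 + a *\<^sub>R axis i 1)
        - partial i u (p + a *\<^sub>R axis i 1)" if "0 \<le> a" "a \<le> s" for a
      using dist'[of a s] dist'[of a 0] that assms(3)
      by (intro DERIV_diff DERIV_along_axis diff) (auto simp: ac_simps)
    from MVT2[OF assms(3) this] that show ?thesis by blast
  qed
  obtain b where b: "0 < b" "b < s"
    "partial i u (p + a *\<^sub>R axis i 1 + s *\<^sub>R axis j 1)
      - partial i u (p + a *\<^sub>R axis i 1 + 0 *\<^sub>R axis j 1)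
      = (s - 0) * partial j (partial i u) (p + a *\<^sub>R axis i 1 + b *\<^sub>R axis j 1)"
  proof -
    have "DERIV (\<lambda>b. partial i u (p + a *\<^sub>R axis i 1 + b *\<^sub>R axis j 1)) b :>
        partial j (partial i u) (p + a *\<^sub>R axis i 1 + b *\<^sub>R axis j 1)" if "0 \<le> b" "b \<le> s" for b
      using dist'[of a b] that a(1,2) by (intro DERIV_along_axis diff) auto
    from MVT2[OF assms(3) this] that show ?thesis by blast
  qed
  show ?thesis
  proof
    show "dist p (p + a *\<^sub>R axis i 1 + b *\<^sub>R axis j 1) \<le> 2 * s"
      using a b by (intro dist) auto
    show "u (p + s *\<^sub>R axis i 1 + s *\<^sub>R axis j 1) - u (p + s *\<^sub>R axis i 1) - u (p + s *\<^sub>R axis j 1)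
        + u p = s\<^sup>2 * partial j (partial i u) (p + a *\<^sub>R axis i 1 + b *\<^sub>R axis j 1)"
      using a(3) b(3) by (simp add: power2_eq_square algebra_simps)
  qed
qed

text \<open>By symmetry of the second difference, both mixed derivatives attain a common value at
  points arbitrarily close to \<open>p\<close>; continuity at \<open>p\<close> closes the
  gap.\<close>

lemma partial_commute:
  fixes u :: "real^'n \<Rightarrow> real"
  assumes "open \<Omega>" "Ck_on 2 \<Omega> u" "p \<in> \<Omega>"
  shows "partial i (partial j u) p = partial j (partial i u) p"
proof (rule ccontr)
  let ?A = "partial i (partial j u)" and ?B = "partial j (partial i u)"
  \<comment> \<open>Half the gap: two numbers within \<open>\<epsilon>\<close> of a common value are
    less than \<open>2 * \<epsilon>\<close> apart.\<close>
  define \<epsilon> where "\<epsilon> = dist (?A p) (?B p) / 2"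
  assume "?A p \<noteq> ?B p"
  then have \<epsilon>: "\<epsilon> > 0" by (simp add: \<epsilon>_def)
  have "isCont ?A p" "isCont ?B p"
    using assms(2,3) by (auto simp: numeral_2_eq_2 continuous_on_eq_continuous_at[OF assms(1)])
  then obtain d1 d2 where d: "d1 > 0" "d2 > 0" "\<And>z. dist z p < d1 \<Longrightarrow> dist (?A z) (?A p) < \<epsilon>"
    "\<And>z. dist z p < d2 \<Longrightarrow> dist (?B z) (?B p) < \<epsilon>"
    using \<epsilon> unfolding continuous_at_eps_delta by metis
  obtain r where r: "r > 0" "ball p r \<subseteq> \<Omega>"
    using assms open_contains_ball by blast
  \<comment> \<open>The mean points lie within \<open>2 * s\<close> of \<open>p\<close>; dividing by
    3 puts \<open>2 * s\<close> strictly below all three radii.\<close>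
  define s where "s = min r (min d1 d2) / 3"
  have s: "s > 0" "2 * s < r" "2 * s < d1" "2 * s < d2"
    using r(1) d(1,2) by (auto simp: s_def min_def)
  obtain z where z: "dist p z \<le> 2 * s" 
    "u (p + s *\<^sub>R axis i 1 + s *\<^sub>R axis j 1) - u (p + s *\<^sub>R axis i 1) - u (p + s *\<^sub>R axis j 1) + u p
      = s\<^sup>2 * ?B z"
    using second_difference[OF assms(2) r(2) s(1,2)] by blast
  obtain z' where z': "dist p z' \<le> 2 * s" 
    "u (p + s *\<^sub>R axis j 1 + s *\<^sub>R axis i 1) - u (p + s *\<^sub>R axis j 1) - u (p + s *\<^sub>R axis i 1) + u p
      = s\<^sup>2 * ?A z'"
    using second_difference[OF assms(2) r(2) s(1,2)] by blast
  have "s\<^sup>2 * ?A z' = s\<^sup>2 * ?B z"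
    unfolding z(2)[symmetric] z'(2)[symmetric] by (simp add: algebra_simps)
  with s(1) have "?A z' = ?B z"
    by (metis mult_left_cancel power_not_zero less_irrefl)
  moreover have "dist (?A z') (?A p) < \<epsilon>" "dist (?B z) (?B p) < \<epsilon>"
    using d(3)[of z'] d(4)[of z] z(1) z'(1) s by (simp_all add: dist_commute)
  ultimately show False
    using dist_triangle3[of "?A p" "?B p" "?A z'"] by (simp add: \<epsilon>_def)
qed

definition laplacian :: "(real^'n \<Rightarrow> real) \<Rightarrow> real^'n \<Rightarrow> real"
  where "laplacian u p = (\<Sum>i\<in>UNIV. partial i (partial i u) p)"

text \<open>The weak equation says that the stress-energy tensor
  \<open>|\<nabla>\<sigma>|\<^sup>2 \<delta>\<^sub>\<beta>\<^sub>\<gamma> - 2 \<partial>\<^sub>\<beta>\<sigma> \<partial>\<^sub>\<gamma>\<sigma>\<close> is divergence free, and its divergence is \<open>-2 \<Delta>\<sigma> \<partial>\<^sub>\<gamma>\<sigma>\<close>. Where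
  \<open>\<Delta>\<sigma> \<noteq> 0\<close>, the gradient would therefore vanish locally, forcing \<open>\<Delta>\<sigma> = 0\<close>.\<close>

lemma laplacian_eq_0_if_stress_energy_divergence_free:
  fixes \<sigma> :: "real^'n \<Rightarrow> real"
  assumes \<Omega>: "open \<Omega>" and \<sigma>: "Ck_on 2 \<Omega> \<sigma>"
    and weak: "\<And>\<phi> \<gamma>. test_function \<Omega> \<phi> \<Longrightarrow>
      (LINT p:\<Omega>|lborel. (\<Sum>\<beta>\<in>UNIV. (partial \<beta> \<sigma> p)\<^sup>2) * partial \<gamma> \<phi> p
        - 2 * (\<Sum>\<beta>\<in>UNIV. partial \<beta> \<sigma> p * partial \<gamma> \<sigma> p * partial \<beta> \<phi> p)) = 0"
    and p: "p \<in> \<Omega>"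
  shows "laplacian \<sigma> p = 0"
proof -
  have \<sigma>1: "Ck_on 1 \<Omega> (partial \<beta> \<sigma>)" for \<beta>
    using \<sigma> by (simp add: numeral_2_eq_2)
  have \<sigma>_diff: "partial \<beta> \<sigma> differentiable (at q)" if "q \<in> \<Omega>" for \<beta> q
    using \<sigma>1[of \<beta>] that by simp
  define N where "N q = (\<Sum>\<alpha>\<in>UNIV. partial \<alpha> \<sigma> q * partial \<alpha> \<sigma> q)" for q
  have N: "Ck_on 1 \<Omega> N"
    unfolding N_def[abs_def] by (intro Ck_on_sum Ck_on_mult \<Omega> \<sigma>1)
  have partial_N: "partial \<gamma> N q = (\<Sum>\<alpha>\<in>UNIV. 2 * (partial \<alpha> \<sigma> q * partial \<gamma> (partial \<alpha> \<sigma>) q))"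
    if "q \<in> \<Omega>" for \<gamma> q
  proof -
    have *: "partial \<alpha> \<sigma> differentiable (at q)" for \<alpha>
      using \<sigma>_diff that by blast
    have "partial \<gamma> N q = (\<Sum>\<alpha>\<in>UNIV. partial \<alpha> \<sigma> q * partial \<gamma> (partial \<alpha> \<sigma>) q
        + partial \<gamma> (partial \<alpha> \<sigma>) q * partial \<alpha> \<sigma> q)"
      unfolding N_def[abs_def]
      by (subst partial_eqI[OF has_derivative_sum[OF has_derivative_mult]])
        (use * in \<open>auto simp: frechet_derivative_works partial_def\<close>)
    then show ?thesis by (simp add: algebra_simps)
  qed
  have laplacian_grad: "laplacian \<sigma> q * partial \<gamma> \<sigma> q = 0" if q: "q \<in> \<Omega>" for q \<gamma>
  proof -
    define \<delta> :: "'n \<Rightarrow> real" where "\<delta> \<beta> = (if \<beta> = \<gamma> then 1 else 0)" for \<beta>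
    \<comment> \<open>Column \<open>\<gamma>\<close> of the stress-energy tensor; its pairing with
      the gradient of \<open>\<phi>\<close> is the integrand of \<open>weak\<close>.\<close>
    define F where "F \<beta> q = \<delta> \<beta> * N q + (- 2) * (partial \<beta> \<sigma> q * partial \<gamma> \<sigma> q)" for \<beta> q
    have F: "Ck_on 1 \<Omega> (F \<beta>)" for \<beta>
      unfolding F_def[abs_def] by (intro Ck_on_add Ck_on_cmult Ck_on_mult \<Omega> \<sigma>1 N)
    have div_F: "(\<Sum>\<beta>\<in>UNIV. partial \<beta> (F \<beta>) q) = (- 2) * (laplacian \<sigma> q * partial \<gamma> \<sigma> q)"
      if q: "q \<in> \<Omega>" for q
    proof -
      have "partial \<beta> (F \<beta>) q = \<delta> \<beta> * partial \<beta> N q +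
          (- 2) * (partial \<beta> (partial \<beta> \<sigma>) q * partial \<gamma> \<sigma> q + partial \<beta> \<sigma> q * partial \<gamma> (partial \<beta> \<sigma>) q)"
        for \<beta>
      proof -
        have d: "N differentiable (at q)" "(\<lambda>p. partial \<beta> \<sigma> p * partial \<gamma> \<sigma> p) differentiable (at q)"
          using N Ck_on_mult[OF \<Omega> \<sigma>1[of \<beta>] \<sigma>1[of \<gamma>]] q by auto
        have "partial \<beta> (F \<beta>) q = \<delta> \<beta> * partial \<beta> N q
            + (- 2) * partial \<beta> (\<lambda>q. partial \<beta> \<sigma> q * partial \<gamma> \<sigma> q) q"
          unfolding F_def[abs_def]
          by (subst partial_add, (intro differentiable_mult differentiable_const d)+,
              subst (1 2) partial_mult, (intro differentiable_mult differentiable_const d)+)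
            simp
        then show ?thesis
          using \<sigma>_diff[OF q] by (simp add: partial_mult partial_commute[OF \<Omega> \<sigma> q, of \<beta> \<gamma>])
      qed
      \<comment> \<open>After commuting derivatives, the mixed terms sum to half of
        \<open>partial \<gamma> N q\<close>. With the factor -2 they cancel the
        \<open>\<delta>\<close> part, and only the Laplacian term remains.\<close>
      then have "(\<Sum>\<beta>\<in>UNIV. partial \<beta> (F \<beta>) q) = (\<Sum>\<beta>\<in>UNIV. \<delta> \<beta> * partial \<beta> N q)
          + (- 2) * ((\<Sum>\<beta>\<in>UNIV. partial \<beta> (partial \<beta> \<sigma>) q * partial \<gamma> \<sigma> q)
            + (\<Sum>\<beta>\<in>UNIV. partial \<beta> \<sigma> q * partial \<gamma> (partial \<beta> \<sigma>) q))"
        by (simp only: sum.distrib sum_distrib_left[symmetric])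
      moreover have "(\<Sum>\<beta>\<in>UNIV. \<delta> \<beta> * partial \<beta> N q) = partial \<gamma> N q"
        by (simp add: \<delta>_def if_distrib[of "\<lambda>x. x * _"] cong: if_cong)
      moreover have "partial \<gamma> N q = 2 * (\<Sum>\<beta>\<in>UNIV. partial \<beta> \<sigma> q * partial \<gamma> (partial \<beta> \<sigma>) q)"
        by (simp only: partial_N[OF q] sum_distrib_left)
      ultimately show ?thesis
        by (simp add: laplacian_def sum_distrib_right)
    qed
    have "(\<Sum>\<beta>\<in>UNIV. partial \<beta> (F \<beta>) q) = 0"
    proof (rule fundamental_lemma_calculus_of_variations[OF \<Omega> _ _ q])
      show "continuous_on \<Omega> (\<lambda>q. \<Sum>\<beta>\<in>UNIV. partial \<beta> (F \<beta>) q)"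
        using F by (intro continuous_on_sum) simp
      fix \<phi> assume \<phi>: "test_function \<Omega> \<phi>"
      have "(\<Sum>\<beta>\<in>UNIV. \<delta> \<beta> * N q * partial \<beta> \<phi> q) = N q * partial \<gamma> \<phi> q" for q
        by (simp add: \<delta>_def if_distrib[of "\<lambda>x. x * _"] cong: if_cong)
      then have "(\<Sum>\<beta>\<in>UNIV. F \<beta> q * partial \<beta> \<phi> q) = (\<Sum>\<beta>\<in>UNIV. (partial \<beta> \<sigma> q)\<^sup>2) * partial \<gamma> \<phi> q
        - 2 * (\<Sum>\<beta>\<in>UNIV. partial \<beta> \<sigma> q * partial \<gamma> \<sigma> q * partial \<beta> \<phi> q)" for q
        by (simp add: F_def distrib_right left_diff_distrib sum.distrib sum_subtractf N_def
            power2_eq_square sum_distrib_left mult.assoc)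
      then show "(LINT q:\<Omega>|lborel. (\<Sum>\<beta>\<in>UNIV. partial \<beta> (F \<beta>) q) * \<phi> q) = 0"
        using integral_divergence_test_function[where F = F, OF \<Omega> F \<phi>] weak[OF \<phi>, of \<gamma>] by simp
    qed
    with div_F[OF q] show ?thesis by simp
  qed
  show ?thesis
  proof (rule ccontr)
    assume nz: "laplacian \<sigma> p \<noteq> 0"
    have cont: "continuous_on \<Omega> (laplacian \<sigma>)"
      unfolding laplacian_def[abs_def] using \<sigma>1 by (intro continuous_on_sum) auto
    define U where "U = {q \<in> \<Omega>. laplacian \<sigma> q \<noteq> 0}"
    have U: "open U"
      using continuous_open_preimage[OF cont \<Omega>, of "- {0}"]
      by (simp add: U_def vimage_def Int_def open_Compl)
    have "partial \<gamma> (partial \<gamma> \<sigma>) p = partial \<gamma> (\<lambda>_. 0) p" for \<gamma>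
      by (rule partial_cong[OF U]) (use nz p laplacian_grad in \<open>auto simp: U_def\<close>)
    with nz show False by (simp add: laplacian_def)
  qed
qed

section \<open>Maximum principle\<close>

text \<open>If \<open>m > 0\<close>, then \<open>\<psi>'\<close>, which is 0 at the maximum, is
  positive just to the right of 0, and by the mean value theorem \<open>\<psi>\<close> rises above
  \<open>\<psi> 0\<close>.\<close>

lemma second_derivative_nonpos_at_local_max:
  fixes \<psi> :: "real \<Rightarrow> real"
  assumes "d > 0" and \<psi>: "\<And>t. \<bar>t\<bar> < d \<Longrightarrow> (\<psi> has_real_derivative \<psi>' t) (at t)"
    and m: "(\<psi>' has_real_derivative m) (at 0)" and max: "\<And>t. \<bar>t\<bar> < d \<Longrightarrow> \<psi> t \<le> \<psi> 0"
  shows "m \<le> 0"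
proof (rule ccontr)
  assume "\<not> m \<le> 0"
  then obtain e where e: "e > 0" "\<And>h. 0 < h \<Longrightarrow> h < e \<Longrightarrow> \<psi>' 0 < \<psi>' h"
    using DERIV_pos_inc_right[OF m] by auto
  have "\<psi>' 0 = 0"
    by (rule DERIV_local_max[OF \<psi>[of 0] \<open>d > 0\<close>]) (use \<open>d > 0\<close> max in auto)
  define h where "h = min d e / 2"
  have h: "0 < h" "h < d" "h < e"
    using \<open>d > 0\<close> e(1) by (auto simp: h_def min_def)
  obtain z where z: "0 < z" "z < h" "\<psi> h - \<psi> 0 = (h - 0) * \<psi>' z"
    using MVT2[OF h(1), of \<psi> \<psi>'] \<psi> h by auto
  have "\<psi>' z > 0" using e(2)[of z] z h \<open>\<psi>' 0 = 0\<close> by simp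
  then have "h * \<psi>' z > 0" using h(1) by simp
  then have "\<psi> h > \<psi> 0" using z(3) by (simp add: algebra_simps)
  then show False using max[of h] h by auto
qed

text \<open>Adding a small multiple of \<open>|p - p0|^2\<close> makes the Laplacian positive, which
  excludes an interior maximum. The boundary condition bounds an upper limit, because
  \<open>w\<close> need not have boundary values.\<close>

lemma weak_maximum_principle:
  fixes w :: "real^'n \<Rightarrow> real"
  assumes \<Omega>: "open \<Omega>" "bounded \<Omega>" and w: "Ck_on 2 \<Omega> w"
    and lap: "\<And>p. p \<in> \<Omega> \<Longrightarrow> laplacian w p = 0"
    and bd: "\<And>p \<epsilon>. p \<in> frontier \<Omega> \<Longrightarrow> 0 < \<epsilon> \<Longrightarrow>
      \<exists>\<delta>>0. \<forall>q\<in>\<Omega>. dist q p < \<delta> \<longrightarrow> w q < \<epsilon>"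
    and p0: "p0 \<in> \<Omega>"
  shows "w p0 \<le> 0"
proof (rule ccontr)
  assume "\<not> w p0 \<le> 0"
  define \<eta> where "\<eta> = w p0"
  have \<eta>: "\<eta> > 0" using \<open>\<not> w p0 \<le> 0\<close> by (simp add: \<eta>_def)
  have w0: "continuous_on \<Omega> w"
    using Ck_on_le[OF w, of 0] by simp
  \<comment> \<open>The boundary condition keeps this superlevel set away from the frontier, so it
    is compact.\<close>
  define K where "K = {p \<in> \<Omega>. w p \<ge> \<eta> / 2}"
  have "p \<in> K" if "p \<in> closure K" for p
  proof (cases "p \<in> \<Omega>")
    case True
    have "open {p \<in> \<Omega>. w p \<in> {..<\<eta> / 2}}"
      using continuous_open_preimage[OF w0 \<Omega>(1), of "{..<\<eta> / 2}"] by (simp add: vimage_def Int_def)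
    moreover have "{p \<in> \<Omega>. w p \<in> {..<\<eta> / 2}} \<inter> K = {}" by (auto simp: K_def)
    ultimately have "p \<notin> {p \<in> \<Omega>. w p \<in> {..<\<eta> / 2}}"
      using that open_Int_closure_eq_empty by blast
    then show ?thesis using True by (simp add: K_def)
  next
    case False
    moreover have "p \<in> closure \<Omega>"
      using that closure_mono[of K \<Omega>] by (auto simp: K_def)
    ultimately have "p \<in> frontier \<Omega>"
      using \<Omega>(1) by (simp add: frontier_def interior_open)
    then obtain \<delta> where \<delta>: "\<delta> > 0" "\<forall>q\<in>\<Omega>. dist q p < \<delta> \<longrightarrow> w q < \<eta> / 2"
      using bd[of p "\<eta> / 2"] \<eta> half_gt_zero by blast
    obtain q where q: "q \<in> K" "dist q p < \<delta>"
      using \<open>p \<in> closure K\<close> \<delta>(1) unfolding closure_approachable by blast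
    then have "w q < \<eta> / 2" "w q \<ge> \<eta> / 2" using \<delta>(2) by (auto simp: K_def)
    then show ?thesis by simp
  qed
  then have "closed K" using closure_subset_eq by blast
  moreover have "bounded K"
    using \<Omega>(2) by (rule bounded_subset) (auto simp: K_def)
  ultimately have "compact K" by (simp add: compact_eq_bounded_closed)
  have "p0 \<in> K" using p0 \<eta> by (simp add: K_def \<eta>_def)
  obtain R where R: "R > 0" "\<And>p. p \<in> \<Omega> \<Longrightarrow> norm (p - p0) \<le> R"
  proof -
    obtain B where "\<forall>p\<in>\<Omega>. norm p \<le> B" using \<Omega>(2) bounded_iff by blast
    then have "norm p \<le> B" "norm p0 \<le> B" if "p \<in> \<Omega>" for p
      using p0 that by auto
    then have "norm (p - p0) \<le> max 1 (2 * B)" if "p \<in> \<Omega>" for p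
      using norm_triangle_ineq4[of p p0] that by fastforce
    then show ?thesis using that[of "max 1 (2 * B)"] by auto
  qed
  \<comment> \<open>On \<open>\<Omega>\<close> the added term is at most \<open>\<eta> / 4\<close>,
    so outside \<open>K\<close> the sum stays below its value \<open>\<eta>\<close> at
    \<open>p0\<close>, and its maximum over \<open>K\<close> is one over
    \<open>\<Omega>\<close>.\<close>
  define \<epsilon> where "\<epsilon> = \<eta> / (4 * R\<^sup>2)"
  have \<epsilon>: "\<epsilon> > 0" using \<eta> R(1) by (simp add: \<epsilon>_def)
  define v where "v p = w p + \<epsilon> * (norm (p - p0))\<^sup>2" for p
  have "continuous_on K v"
    unfolding v_def[abs_def]
    by (intro continuous_intros continuous_on_subset[OF w0]) (auto simp: K_def)
  then obtain q where q: "q \<in> K" "\<And>p. p \<in> K \<Longrightarrow> v p \<le> v q"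
    using continuous_attains_sup[OF \<open>compact K\<close>] \<open>p0 \<in> K\<close> by blast
  have q_max: "v p \<le> v q" if p: "p \<in> \<Omega>" for p
  proof (cases "p \<in> K")
    case False
    have "\<epsilon> * (norm (p - p0))\<^sup>2 \<le> \<epsilon> * R\<^sup>2"
      using R(2)[OF p] \<epsilon> by (intro mult_left_mono power_mono) auto
    also have "\<dots> = \<eta> / 4" using R(1) by (simp add: \<epsilon>_def)
    finally have "v p \<le> \<eta>" using False p \<eta> by (simp add: v_def K_def)
    also have "\<eta> = v p0" by (simp add: v_def \<eta>_def)
    also have "\<dots> \<le> v q" using q(2) \<open>p0 \<in> K\<close> by blast
    finally show ?thesis .
  qed (use q in simp)
  have q\<Omega>: "q \<in> \<Omega>" using q(1) by (simp add: K_def)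
  then obtain d where d: "d > 0" "ball q d \<subseteq> \<Omega>"
    using \<Omega>(1) open_contains_ball by blast
  have "partial i (partial i w) q + 2 * \<epsilon> \<le> 0" for i
  proof (rule second_derivative_nonpos_at_local_max[OF d(1)])
    let ?c = "(q - p0) $ i"
    \<comment> \<open>Up to the constant \<open>\<epsilon> * |q - p0|^2\<close> this is
      \<open>v\<close> on the line through \<open>q\<close> along axis \<open>i\<close>.\<close>
    let ?\<psi> = "\<lambda>t. w (q + t *\<^sub>R axis i 1) + \<epsilon> * (2 * t * ?c + t\<^sup>2)"
    have in_\<Omega>: "q + t *\<^sub>R axis i 1 \<in> \<Omega>" if "\<bar>t\<bar> < d" for t
      using d(2) that by (auto simp: dist_norm)
    have diff: "w differentiable (at p)" "partial i w differentiable (at p)" if "p \<in> \<Omega>" for p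
      using w that by (auto simp: numeral_2_eq_2)
    show "(?\<psi> has_real_derivative partial i w (q + t *\<^sub>R axis i 1) + \<epsilon> * (2 * ?c + 2 * t)) (at t)"
      if "\<bar>t\<bar> < d" for t
      by (rule DERIV_along_axis[OF diff(1)[OF in_\<Omega>[OF that]], THEN DERIV_add])
        (auto intro!: derivative_eq_intros)
    show "((\<lambda>t. partial i w (q + t *\<^sub>R axis i 1) + \<epsilon> * (2 * ?c + 2 * t)) has_real_derivative
        partial i (partial i w) q + 2 * \<epsilon>) (at 0)"
      using DERIV_along_axis[of "partial i w" q 0 i] diff(2)[OF q\<Omega>]
      by (intro DERIV_add) (auto intro!: derivative_eq_intros)
    have v_eq: "v (q + t *\<^sub>R axis i 1) = ?\<psi> t + \<epsilon> * (norm (q - p0))\<^sup>2" for t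
    proof -
      have "q + t *\<^sub>R axis i 1 - p0 = (q - p0) + t *\<^sub>R axis i 1" by simp
      then have "(norm (q + t *\<^sub>R axis i 1 - p0))\<^sup>2 = (norm (q - p0))\<^sup>2 + 2 * t * ?c + t\<^sup>2"
        by (simp only: power2_norm_eq_inner)
          (simp add: inner_add_left inner_add_right inner_axis inner_axis' inner_axis_axis
            power2_eq_square algebra_simps)
      then show ?thesis by (simp only: v_def) (simp add: algebra_simps)
    qed
    show "?\<psi> t \<le> ?\<psi> 0" if "\<bar>t\<bar> < d" for t
      using q_max[OF in_\<Omega>[OF that]] v_eq[of t] v_eq[of 0] by simp
  qed
  then have "partial i (partial i w) q \<le> - 2 * \<epsilon>" for i
    using add_mono[of "partial i (partial i w) q + 2 * \<epsilon>" 0 "- 2 * \<epsilon>" "- 2 * \<epsilon>"] by simp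
  then have "(\<Sum>i\<in>UNIV. partial i (partial i w) q) \<le> (\<Sum>i\<in>(UNIV :: 'n set). - 2 * \<epsilon>)"
    by (rule sum_mono)
  also have "\<dots> < 0" using \<epsilon> by (simp add: mult_neg_pos)
  finally show False using lap[OF q\<Omega>] by (simp add: laplacian_def)
qed

section \<open>Comparison of functions that become harmonic after composition with
  \<open>G\<close>\<close>

lemma laplacian_diff:
  assumes "open \<Omega>" "Ck_on 2 \<Omega> u" "Ck_on 2 \<Omega> v" "p \<in> \<Omega>"
  shows "laplacian (\<lambda>p. u p - v p) p = laplacian u p - laplacian v p"
proof -
  have partial_diff: "partial i (\<lambda>p. a p - b p) q = partial i a q - partial i b q"
    if "a differentiable (at q)" "b differentiable (at q)" for a b :: "real^'n \<Rightarrow> real" and i q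
    using that unfolding frechet_derivative_works
    by (subst partial_eqI[OF has_derivative_diff]) (auto simp: partial_def)
  have "partial i (partial i (\<lambda>p. u p - v p)) p = partial i (\<lambda>q. partial i u q - partial i v q) p" for i
    by (rule partial_cong[OF assms(1,4)], rule partial_diff)
      (use assms in \<open>auto simp: numeral_2_eq_2\<close>)
  also have "\<dots> i = partial i (partial i u) p - partial i (partial i v) p" for i
    by (rule partial_diff) (use assms in \<open>auto simp: numeral_2_eq_2\<close>)
  finally show ?thesis by (simp add: laplacian_def sum_subtractf)
qed

lemma Ck_on_diff:
  fixes u v :: "real^'n \<Rightarrow> real"
  assumes "open \<Omega>" "Ck_on k \<Omega> u" "Ck_on k \<Omega> v"
  shows "Ck_on k \<Omega> (\<lambda>p. u p - v p)"
  by (rule Ck_on_cong[OF assms(1) _ Ck_on_add[OF assms(1,2) Ck_on_cmult[OF assms(1,3), of "- 1"]]]) simp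

text \<open>At an end point \<open>c\<close> of \<open>I\<close> that does not belong to \<open>I\<close>, this says that \<open>G\<close> has a finite limit
  there.\<close>

definition Cauchy_within :: "real set \<Rightarrow> (real \<Rightarrow> real) \<Rightarrow> real \<Rightarrow> bool"
  where "Cauchy_within I G c \<longleftrightarrow> (\<forall>\<epsilon>>0. \<exists>\<delta>>0. \<forall>s\<in>I. \<forall>t\<in>I.
    \<bar>s - c\<bar> < \<delta> \<longrightarrow> \<bar>t - c\<bar> < \<delta> \<longrightarrow> \<bar>G s - G t\<bar> < \<epsilon>)"

lemma Cauchy_within_if_continuous:
  assumes "continuous_on I G" "c \<in> I"
  shows "Cauchy_within I G c"
  unfolding Cauchy_within_def
proof (intro allI impI)
  fix \<epsilon> :: real assume "\<epsilon> > 0"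
  then obtain \<delta> where \<delta>: "\<delta> > 0" "\<And>s. s \<in> I \<Longrightarrow> dist s c < \<delta> \<Longrightarrow> dist (G s) (G c) < \<epsilon> / 2"
    using assms unfolding continuous_on_iff by (meson half_gt_zero)
  have "\<bar>G s - G t\<bar> < \<epsilon>" if "s \<in> I" "t \<in> I" "\<bar>s - c\<bar> < \<delta>" "\<bar>t - c\<bar> < \<delta>" for s t
    using \<delta>(2)[of s] \<delta>(2)[of t] dist_triangle_half_l[of "G s" "G c" \<epsilon> "G t"] that
    by (simp add: dist_real_def)
  with \<delta>(1) show "\<exists>\<delta>>0. \<forall>s\<in>I. \<forall>t\<in>I. \<bar>s - c\<bar> < \<delta> \<longrightarrow> \<bar>t - c\<bar> < \<delta> \<longrightarrow> \<bar>G s - G t\<bar> < \<epsilon>"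
    by blast
qed

text \<open>The weak maximum principle for the difference of \<open>G\<close> after \<open>u\<close>
  and \<open>G\<close> after \<open>v\<close>. A common boundary value may be an end point missing
  from \<open>I\<close>; there \<open>Cauchy_within\<close> replaces continuity of
  \<open>G\<close>.\<close>

lemma comparison_principle:
  fixes u v :: "real^'n \<Rightarrow> real"
  assumes \<Omega>: "open \<Omega>" "bounded \<Omega>"
    and cont: "continuous_on (closure \<Omega>) u" "continuous_on (closure \<Omega>) v"
    and range: "u ` \<Omega> \<subseteq> I" "v ` \<Omega> \<subseteq> I" and G: "strict_mono_on I G"
    and C2: "Ck_on 2 \<Omega> (\<lambda>p. G (u p))" "Ck_on 2 \<Omega> (\<lambda>p. G (v p))"
    and lap: "\<And>p. p \<in> \<Omega> \<Longrightarrow> laplacian (\<lambda>p. G (u p)) p = 0"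
      "\<And>p. p \<in> \<Omega> \<Longrightarrow> laplacian (\<lambda>p. G (v p)) p = 0"
    and bd: "\<And>p. p \<in> frontier \<Omega> \<Longrightarrow> u p < v p \<or> u p = v p \<and> Cauchy_within I G (u p)"
    and p0: "p0 \<in> \<Omega>"
  shows "u p0 \<le> v p0"
proof -
  have "G (u p0) - G (v p0) \<le> 0"
  proof (rule weak_maximum_principle[OF \<Omega> _ _ _ p0])
    show "Ck_on 2 \<Omega> (\<lambda>p. G (u p) - G (v p))" by (rule Ck_on_diff[OF \<Omega>(1) C2])
    show "laplacian (\<lambda>p. G (u p) - G (v p)) p = 0" if "p \<in> \<Omega>" for p
      by (simp add: laplacian_diff[OF \<Omega>(1) C2 that] lap that)
    fix p and \<epsilon> :: real assume p: "p \<in> frontier \<Omega>" and \<epsilon>: "0 < \<epsilon>"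
    have near: "\<exists>\<delta>>0. \<forall>q\<in>\<Omega>. dist q p < \<delta> \<longrightarrow> \<bar>u q - u p\<bar> < r \<and> \<bar>v q - v p\<bar> < r"
      if "r > 0" for r
    proof -
      have "p \<in> closure \<Omega>" using p by (simp add: frontier_def)
      then obtain a where a: "a > 0" "\<forall>q\<in>closure \<Omega>. dist q p < a \<longrightarrow> dist (u q) (u p) < r"
        using cont(1) \<open>r > 0\<close> unfolding continuous_on_iff by blast
      obtain b where b: "b > 0" "\<forall>q\<in>closure \<Omega>. dist q p < b \<longrightarrow> dist (v q) (v p) < r"
        using \<open>p \<in> closure \<Omega>\<close> cont(2) \<open>r > 0\<close> unfolding continuous_on_iff by blast
      have "\<forall>q\<in>\<Omega>. dist q p < min a b \<longrightarrow> \<bar>u q - u p\<bar> < r \<and> \<bar>v q - v p\<bar> < r"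
        using a(2) b(2) closure_subset[of \<Omega>] by (auto simp: dist_real_def subset_iff)
      then show ?thesis using a(1) b(1) by (intro exI[of _ "min a b"]) simp
    qed
    show "\<exists>\<delta>>0. \<forall>q\<in>\<Omega>. dist q p < \<delta> \<longrightarrow> G (u q) - G (v q) < \<epsilon>"
    proof (cases "u p < v p")
      case True
      \<comment> \<open>Near \<open>p\<close> the values of \<open>u\<close> and \<open>v\<close>
        stay on opposite sides of the midpoint of \<open>u p\<close> and \<open>v p\<close>, so
        monotonicity of \<open>G\<close> suffices.\<close>
      then obtain \<delta> where \<delta>: "\<delta> > 0"
        "\<forall>q\<in>\<Omega>. dist q p < \<delta> \<longrightarrow> \<bar>u q - u p\<bar> < (v p - u p) / 2 \<and> \<bar>v q - v p\<bar> < (v p - u p) / 2"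
        using near[of "(v p - u p) / 2"] by auto
      have "G (u q) - G (v q) < \<epsilon>" if q: "q \<in> \<Omega>" "dist q p < \<delta>" for q
      proof -
        have "\<bar>u q - u p\<bar> < (v p - u p) / 2" "\<bar>v q - v p\<bar> < (v p - u p) / 2"
          using \<delta>(2) q by blast+
        then have "u q < v q"
          using abs_ge_self[of "u q - u p"] abs_ge_minus_self[of "v q - v p"] by (simp add: field_simps)
        then have "G (u q) < G (v q)"
          using strict_mono_onD[OF G] range q by blast
        then show ?thesis using \<epsilon> by simp
      qed
      then show ?thesis using \<delta>(1) by blast
    next
      case False
      then have eq: "u p = v p" and "Cauchy_within I G (u p)" using bd[OF p] by auto
      then obtain r where r: "r > 0"
        "\<forall>s\<in>I. \<forall>t\<in>I. \<bar>s - u p\<bar> < r \<longrightarrow> \<bar>t - u p\<bar> < r \<longrightarrow> \<bar>G s - G t\<bar> < \<epsilon>"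
        using \<epsilon> unfolding Cauchy_within_def by blast
      obtain \<delta> where \<delta>: "\<delta> > 0" "\<forall>q\<in>\<Omega>. dist q p < \<delta> \<longrightarrow> \<bar>u q - u p\<bar> < r \<and> \<bar>v q - v p\<bar> < r"
        using near[OF r(1)] by blast
      have "\<bar>G (u q) - G (v q)\<bar> < \<epsilon>" if q: "q \<in> \<Omega>" "dist q p < \<delta>" for q
        using r(2) \<delta>(2) q range unfolding eq by (metis image_subset_iff)
      then show ?thesis using \<delta>(1) by fastforce
    qed
  qed
  then have "G (u p0) \<le> G (v p0)" by simp
  then show ?thesis
    using strict_mono_onD[OF G, of "v p0" "u p0"] range p0 by force
qed

section \<open>Functions on intervals\<close>

lemma real_interval_subset:
  assumes "is_interval J" "x \<in> J" "y \<in> J"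
  shows "{x..y} \<subseteq> (J :: real set)"
  using mem_is_interval_1_I[OF assms] by auto

lemma mvt_within_interval:
  fixes F :: "real \<Rightarrow> real"
  assumes J: "is_interval J" "x \<in> J" "y \<in> J" "x \<le> y"
    and F: "\<And>z. z \<in> J \<Longrightarrow> (F has_real_derivative F' z) (at z within J)"
  obtains z where "z \<in> {x..y}" "F y - F x = F' z * (y - x)"
proof -
  note sub = real_interval_subset[OF J(1-3)]
  have "(F has_derivative (*) (F' z)) (at z within {x..y})" if "x \<le> z" "z \<le> y" for z
    using F[of z] sub that has_field_derivative_subset[of F "F' z" z J "{x..y}"]
    unfolding has_field_derivative_def by auto
  from mvt_very_simple[OF J(4) this] that show ?thesis by auto
qed

text \<open>The slope \<open>A\<close> is non-increasing, so the mean slope between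
  \<open>s0\<close> and \<open>s\<close> is at most \<open>A s0\<close> to the right of
  \<open>s0\<close> and at least \<open>A s0\<close> to the left.\<close>

lemma concave_below_tangent:
  fixes L :: "real \<Rightarrow> real"
  assumes J: "is_interval J" "s0 \<in> J" "s \<in> J"
    and L: "\<And>t. t \<in> J \<Longrightarrow> (L has_real_derivative A t) (at t within J)"
    and A: "\<And>t. t \<in> J \<Longrightarrow> (A has_real_derivative A' t) (at t within J)"
    and neg: "\<And>t. t \<in> J \<Longrightarrow> A' t \<le> 0"
  shows "L s \<le> L s0 + A s0 * (s - s0)"
proof -
  have anti: "A y \<le> A x" if xy: "x \<in> J" "y \<in> J" "x \<le> y" for x y
  proof -
    obtain z where z: "z \<in> {x..y}" "A y - A x = A' z * (y - x)"
      using mvt_within_interval[OF J(1) xy A] by blast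
    then have "A' z \<le> 0" using neg real_interval_subset[OF J(1) xy(1,2)] by blast
    then have "A' z * (y - x) \<le> 0" using xy(3) by (simp add: mult_nonpos_nonneg)
    with z(2) show ?thesis by simp
  qed
  show ?thesis
  proof (cases "s0 \<le> s")
    case True
    obtain z where z: "z \<in> {s0..s}" "L s - L s0 = A z * (s - s0)"
      using mvt_within_interval[OF J(1,2,3) True L] by blast
    have "A z \<le> A s0"
      using z(1) real_interval_subset[OF J] by (intro anti J) auto
    then have "A z * (s - s0) \<le> A s0 * (s - s0)" using True by (intro mult_right_mono) auto
    with z(2) show ?thesis by simp
  next
    case False
    then have le: "s \<le> s0" by simp
    obtain z where z: "z \<in> {s..s0}" "L s0 - L s = A z * (s0 - s)"
      using mvt_within_interval[OF J(1,3,2) le L] by blast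
    have "A s0 \<le> A z"
      using z(1) real_interval_subset[OF J(1,3,2)] by (intro anti J) auto
    then have "A s0 * (s0 - s) \<le> A z * (s0 - s)" using False by (intro mult_right_mono) auto
    with z(2) show ?thesis by (simp add: algebra_simps)
  qed
qed

text \<open>The fundamental theorem of calculus is applied on a compact subinterval that coincides
  with \<open>I\<close> near \<open>s\<close>; \<open>I\<close> itself may be half-open or
  unbounded.\<close>

lemma antiderivative_on_interval:
  fixes g :: "real \<Rightarrow> real"
  assumes I: "is_interval I" and g: "continuous_on I g"
  obtains G where "\<And>s. s \<in> I \<Longrightarrow> (G has_real_derivative g s) (at s within I)"
proof (cases "I = {}")
  case False
  then obtain a where a: "a \<in> I" by blast
  define G where "G s = (if a \<le> s then integral {a..s} g else - integral {s..a} g)" for s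
  have "(G has_real_derivative g s) (at s within I)" if s: "s \<in> I" for s
  proof -
    \<comment> \<open>If \<open>s\<close> is the right end point of \<open>I\<close>, then
      \<open>d = s\<close>; otherwise \<open>d\<close> lies beyond \<open>s\<close>. Below
      \<open>d'\<close> no point of \<open>I\<close> exceeds \<open>d\<close>. The pair
      \<open>c\<close>, \<open>c'\<close> mirrors this on the left.\<close>
    obtain d d' where d: "d \<in> I" "a \<le> d" "s \<le> d" "s < d'" "\<And>t. t \<in> I \<Longrightarrow> t < d' \<Longrightarrow> t \<le> d"
    proof (cases "\<exists>d\<in>I. s < d")
      case True
      then obtain d where "d \<in> I" "s < d" by blast
      with a show ?thesis by (intro that[of "max a d" d]) (auto simp: max_def)
    next
      case False
      with a s show ?thesis by (intro that[of s "s + 1"]) force+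
    qed
    obtain c c' where c: "c \<in> I" "c \<le> a" "c \<le> s" "c' < s" "\<And>t. t \<in> I \<Longrightarrow> c' < t \<Longrightarrow> c \<le> t"
    proof (cases "\<exists>c\<in>I. c < s")
      case True
      then obtain c where "c \<in> I" "c < s" by blast
      with a show ?thesis by (intro that[of "min a c" c]) (auto simp: min_def)
    next
      case False
      with a s show ?thesis by (intro that[of s "s - 1"]) force+
    qed
    have sub: "{c..d} \<subseteq> I" by (rule real_interval_subset[OF I c(1) d(1)])
    have g': "continuous_on {c..d} g" by (rule continuous_on_subset[OF g sub])
    have int: "g integrable_on {x..y}" if "c \<le> x" "y \<le> d" for x y
      using that by (intro integrable_continuous_real continuous_on_subset[OF g']) auto
    have G_eq: "G t = integral {c..t} g - integral {c..a} g" if t: "t \<in> {c..d}" for t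
    proof (cases "a \<le> t")
      case True
      then show ?thesis
        using Henstock_Kurzweil_Integration.integral_combine[OF c(2) True int] t by (simp add: G_def)
    next
      case False
      then show ?thesis
        using Henstock_Kurzweil_Integration.integral_combine[of c t a g] int[of c a] t d(2)
        by (simp add: G_def)
    qed
    have sI: "s \<in> {c..d}" using c d by auto
    have "((\<lambda>t. integral {c..t} g - integral {c..a} g) has_real_derivative g s - 0) (at s within {c..d})"
      by (intro DERIV_diff integral_has_real_derivative[OF g' sI] DERIV_const)
    then have "((\<lambda>t. integral {c..t} g - integral {c..a} g) has_real_derivative g s) (at s within {c..d})"
      by simp
    then have "(G has_real_derivative g s) (at s within {c..d})"
      by (rule has_field_derivative_transform_within[OF _ zero_less_one sI]) (simp add: G_eq)
    moreover have "at s within I = at s within {c..d}"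
      by (rule at_within_nhd[of s "{c'<..<d'}"]) (use c d sub in auto)
    ultimately show ?thesis by simp
  qed
  with that show ?thesis by blast
qed (use that in auto)

section \<open>Harmonic curves\<close>

lemma Ck_on_interval_DERIV:
  assumes "Ck_on_interval k I h" "j < k" "s \<in> I"
  shows "((deriv_within I ^^ j) h has_real_derivative (deriv_within I ^^ Suc j) h s) (at s within I)"
proof -
  have "(deriv_within I ^^ j) h differentiable (at s within I)"
    using assms by (simp add: Ck_on_interval_def)
  then show ?thesis
    by (simp add: vector_derivative_works deriv_within_def
        has_real_derivative_iff_has_vector_derivative)
qed

text \<open>\<open>G\<close> is the arc length of the graph of \<open>H\<close>, so \<open>\<sigma> = G \<circ> Y f\<close> has the same
  energy and stress-energy tensor as the planar map \<open>(X f, Y f)\<close>.\<close>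

lemma harmonic_curve_arc_length:
  fixes f :: "real^'n \<Rightarrow> heisenberg"
  assumes \<Omega>: "open \<Omega>" and f: "harmonic_curve \<Omega> f" "corresponds_to \<Omega> f I H"
    and H: "\<And>s. s \<in> I \<Longrightarrow> (H has_real_derivative h1 s) (at s within I)"
    and h1: "\<And>s. s \<in> I \<Longrightarrow> (h1 has_real_derivative h2 s) (at s within I)"
    and h2: "continuous_on I h2"
    and G: "\<And>s. s \<in> I \<Longrightarrow> (G has_real_derivative sqrt (1 + (h1 s)\<^sup>2)) (at s within I)"
  shows "Ck_on 2 \<Omega> (\<lambda>p. G (Y f p))"
    and "p \<in> \<Omega> \<Longrightarrow> laplacian (\<lambda>p. G (Y f p)) p = 0"
proof -
  let ?\<sigma> = "\<lambda>p. G (Y f p)"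
  have range: "Y f ` \<Omega> \<subseteq> I" and X_eq: "\<And>p. p \<in> \<Omega> \<Longrightarrow> X f p = H (Y f p)"
    using f(2) by (auto simp: corresponds_to_def)
  have pos: "1 + (h1 s)\<^sup>2 > 0" for s by (simp add: add_pos_nonneg)
  have Y_comp: "Y f = (\<lambda>p. f p $ 2)" by (simp add: fun_eq_iff Y_def)
  have Y2: "Ck_on 2 \<Omega> (Y f)"
    unfolding Y_comp using f(1)
    by (intro Ck_on_bounded_linear[OF \<Omega> bounded_linear_vec_nth]) (simp add: harmonic_curve_def)
  then have Y_diff: "Y f differentiable (at p)" if "p \<in> \<Omega>" for p
    using that by (simp add: numeral_2_eq_2)
  \<comment> \<open>\<open>G\<close> and its first two derivatives as the sequence for
    \<open>Ck_on_chain\<close>; indices above 2 repeat the last entry.\<close>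
  let ?k = "\<lambda>j :: nat. if j = 0 then G else if j = 1 then (\<lambda>s. sqrt (1 + (h1 s)\<^sup>2))
    else (\<lambda>s. h1 s * h2 s / sqrt (1 + (h1 s)\<^sup>2))"
  have DERIV_sqrt: "((\<lambda>s. sqrt (1 + (h1 s)\<^sup>2)) has_real_derivative
      h1 s * h2 s / sqrt (1 + (h1 s)\<^sup>2)) (at s within I)" if "s \<in> I" for s
  proof -
    have "((\<lambda>s. 1 + (h1 s)\<^sup>2) has_real_derivative 2 * h1 s * h2 s) (at s within I)"
      by (auto intro!: derivative_eq_intros h1[OF that])
    from DERIV_chain2[OF DERIV_real_sqrt[OF pos] this] show ?thesis
      by (simp add: field_simps)
  qed
  have h1_cont: "continuous_on I h1" by (rule DERIV_continuous_on[OF h1])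
  have "Ck_on (2 - 0) \<Omega> (\<lambda>p. ?k 0 (Y f p))"
  proof (rule Ck_on_chain[where h = ?k and k = 2 and j = 0, OF \<Omega> range _ _ Y2])
    show "(?k j has_real_derivative ?k (Suc j) s) (at s within I)" if "j < 2" "s \<in> I" for j s
      using that G[of s] DERIV_sqrt[of s] by (cases j) auto
    have "continuous_on I (\<lambda>s. h1 s * h2 s / sqrt (1 + (h1 s)\<^sup>2))"
      using pos by (intro continuous_intros h1_cont h2) (auto simp: less_le)
    then show "continuous_on I (?k 2)" by simp
  qed simp
  then show \<sigma>2: "Ck_on 2 \<Omega> ?\<sigma>" by simp
  have \<sigma>1: "partial \<beta> ?\<sigma> p = sqrt (1 + (h1 (Y f p))\<^sup>2) * partial \<beta> (Y f) p" if "p \<in> \<Omega>" for \<beta> p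
    using range that by (intro partial_chain(2)[OF \<Omega> range that Y_diff[OF that]] G) auto
  have X1: "partial \<beta> (X f) p = h1 (Y f p) * partial \<beta> (Y f) p" if "p \<in> \<Omega>" for \<beta> p
  proof -
    have "partial \<beta> (X f) p = partial \<beta> (\<lambda>p. H (Y f p)) p"
      by (rule partial_cong[OF \<Omega> that]) (simp add: X_eq)
    also have "\<dots> = h1 (Y f p) * partial \<beta> (Y f) p"
      using range that by (intro partial_chain(2)[OF \<Omega> range that Y_diff[OF that]] H) auto
    finally show ?thesis .
  qed
  \<comment> \<open>The gradient of \<open>X f\<close> is \<open>h1\<close> times that of
    \<open>Y f\<close>, so the left side carries the factor \<open>1 + h1^2\<close>, the square of
    the derivative of \<open>G\<close>.\<close>
  have metric: "partial \<beta> (X f) p * partial \<gamma> (X f) p + partial \<beta> (Y f) p * partial \<gamma> (Y f) p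
      = partial \<beta> ?\<sigma> p * partial \<gamma> ?\<sigma> p" if "p \<in> \<Omega>" for \<beta> \<gamma> p
  proof -
    let ?r = "sqrt (1 + (h1 (Y f p))\<^sup>2)"
    have "partial \<beta> ?\<sigma> p * partial \<gamma> ?\<sigma> p = ?r * ?r * (partial \<beta> (Y f) p * partial \<gamma> (Y f) p)"
      by (simp add: \<sigma>1[OF that] mult_ac)
    also have "?r * ?r = 1 + (h1 (Y f p))\<^sup>2"
      using pos[of "Y f p"] by simp
    finally show ?thesis
      by (simp add: X1[OF that] power2_eq_square algebra_simps)
  qed
  have energy: "horizontal_energy_density f p = (\<Sum>\<beta>\<in>UNIV. (partial \<beta> ?\<sigma> p)\<^sup>2)" if "p \<in> \<Omega>" for p
    by (simp add: horizontal_energy_density_def power2_eq_square metric[OF that, symmetric] sum.distrib)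
  show "laplacian ?\<sigma> p = 0" if "p \<in> \<Omega>"
  proof (rule laplacian_eq_0_if_stress_energy_divergence_free[OF \<Omega> \<sigma>2 _ that])
    fix \<phi> \<gamma> assume "test_function \<Omega> \<phi>"
    then have "(LINT p:\<Omega>|lborel. horizontal_energy_density f p * partial \<gamma> \<phi> p
      - 2 * (\<Sum>\<beta>\<in>UNIV. (partial \<beta> (X f) p * partial \<gamma> (X f) p
                        + partial \<beta> (Y f) p * partial \<gamma> (Y f) p) * partial \<beta> \<phi> p)) = 0"
      using f(1) unfolding harmonic_curve_def critical_on_def by blast
    moreover have "(LINT p:\<Omega>|lborel. horizontal_energy_density f p * partial \<gamma> \<phi> p
      - 2 * (\<Sum>\<beta>\<in>UNIV. (partial \<beta> (X f) p * partial \<gamma> (X f) p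
                        + partial \<beta> (Y f) p * partial \<gamma> (Y f) p) * partial \<beta> \<phi> p))
      = (LINT p:\<Omega>|lborel. (\<Sum>\<beta>\<in>UNIV. (partial \<beta> ?\<sigma> p)\<^sup>2) * partial \<gamma> \<phi> p
        - 2 * (\<Sum>\<beta>\<in>UNIV. partial \<beta> ?\<sigma> p * partial \<gamma> ?\<sigma> p * partial \<beta> \<phi> p))"
      unfolding set_lebesgue_integral_def
      by (rule Bochner_Integration.integral_cong) (auto simp: indicator_def energy metric)
    ultimately show "(LINT p:\<Omega>|lborel. (\<Sum>\<beta>\<in>UNIV. (partial \<beta> ?\<sigma> p)\<^sup>2) * partial \<gamma> \<phi> p
        - 2 * (\<Sum>\<beta>\<in>UNIV. partial \<beta> ?\<sigma> p * partial \<gamma> ?\<sigma> p * partial \<beta> \<phi> p)) = 0"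
      by simp
  qed
qed

text \<open>A log-concave \<open>g\<close> is bounded on bounded sets, so \<open>G\<close> is Lipschitz even up to an excluded end
  point of \<open>I\<close>.\<close>

lemma Cauchy_within_if_log_concave:
  fixes G g :: "real \<Rightarrow> real"
  assumes I: "is_interval I" and C: "is_interval C" "bounded C"
    and G: "\<And>s. s \<in> I \<Longrightarrow> (G has_real_derivative g s) (at s within I)"
    and g: "\<And>s. s \<in> I \<Longrightarrow> g s > 0"
    and tangent: "\<And>s s0. s \<in> I \<inter> C \<Longrightarrow> s0 \<in> I \<inter> C \<Longrightarrow> ln (g s) \<le> ln (g s0) + a s0 * (s - s0)"
    and s0: "s0 \<in> I \<inter> C" and c: "c \<in> C"
  shows "Cauchy_within I G c"
proof (cases "c \<in> I")
  case True
  then show ?thesis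
    using Cauchy_within_if_continuous[OF DERIV_continuous_on[OF G]] by blast
next
  case False
  then have "s0 \<noteq> c" using s0 by blast
  \<comment> \<open>As \<open>c\<close> is not in \<open>I\<close>, all of \<open>I\<close> lies on
    one side of \<open>c\<close>. Points of \<open>I\<close> nearer to \<open>c\<close> than
    \<open>s0\<close> lie between \<open>s0\<close> and \<open>c\<close>, hence in
    \<open>C\<close>.\<close>
  have near: "t \<in> I \<inter> C" if t: "t \<in> I" "\<bar>t - c\<bar> < \<bar>s0 - c\<bar>" for t
  proof (cases "s0 < c")
    case True
    have "t < c"
      using mem_is_interval_1_I[OF I, of s0 t c] s0 t(1) False True by force
    then show ?thesis
      using mem_is_interval_1_I[OF C(1), of s0 c t] s0 t c True by auto
  next
    case False
    have "t > c"
      using mem_is_interval_1_I[OF I, of t s0 c] s0 t(1) \<open>c \<notin> I\<close> False by force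
    then show ?thesis
      using mem_is_interval_1_I[OF C(1), of c s0 t] s0 t c False by auto
  qed
  obtain B where B: "\<And>s. s \<in> C \<Longrightarrow> \<bar>s\<bar> \<le> B"
    using C(2) unfolding bounded_iff by auto
  \<comment> \<open>The exponential of the tangent line at \<open>s0\<close>, estimated with
    \<open>|s - s0| \<le> 2 * B\<close>.\<close>
  define M where "M = exp (ln (g s0) + \<bar>a s0\<bar> * (2 * B))"
  have M: "g s \<le> M" if "s \<in> I \<inter> C" for s
  proof -
    have "\<bar>s - s0\<bar> \<le> 2 * B" using B[of s] B[of s0] that s0 by auto
    then have "\<bar>a s0 * (s - s0)\<bar> \<le> \<bar>a s0\<bar> * (2 * B)"
      by (simp add: abs_mult mult_left_mono)
    then have "ln (g s) \<le> ln (g s0) + \<bar>a s0\<bar> * (2 * B)"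
      using tangent[OF that s0] by linarith
    then have "exp (ln (g s)) \<le> M" by (simp add: M_def)
    then show ?thesis using g[of s] that by simp
  qed
  have lip: "\<bar>G t - G s\<bar> \<le> M * (t - s)" if st: "s \<in> I \<inter> C" "t \<in> I \<inter> C" "s \<le> t" for s t
  proof -
    obtain z where z: "z \<in> {s..t}" "G t - G s = g z * (t - s)"
      using mvt_within_interval[OF I _ _ st(3) G] st(1,2) by blast
    have "z \<in> I \<inter> C"
      using real_interval_subset[OF I, of s t] real_interval_subset[OF C(1), of s t] st z(1) by blast
    then show ?thesis
      using z(2) M[of z] g[of z] st(3) by (auto simp: abs_mult mult_right_mono)
  qed
  have lip: "\<bar>G s - G t\<bar> \<le> M * \<bar>s - t\<bar>" if "s \<in> I \<inter> C" "t \<in> I \<inter> C" for s t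
    using lip[of s t] lip[of t s] that by (cases "s \<le> t") (auto simp: abs_minus_commute)
  have "M > 0" by (simp add: M_def)
  show ?thesis
    unfolding Cauchy_within_def
  proof (intro allI impI)
    fix \<epsilon> :: real assume "\<epsilon> > 0"
    \<comment> \<open>The first bound keeps the points in \<open>C\<close>; the second makes the
      Lipschitz estimate over a distance below \<open>2 * \<delta>\<close> at most
      \<open>\<epsilon>\<close>.\<close>
    define \<delta> where "\<delta> = min \<bar>s0 - c\<bar> (\<epsilon> / (2 * M))"
    have "\<delta> > 0" using \<open>s0 \<noteq> c\<close> \<open>\<epsilon> > 0\<close> \<open>M > 0\<close> by (simp add: \<delta>_def)
    moreover have "\<bar>G s - G t\<bar> < \<epsilon>" if "s \<in> I" "t \<in> I" "\<bar>s - c\<bar> < \<delta>" "\<bar>t - c\<bar> < \<delta>" for s t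
    proof -
      have "s \<in> I \<inter> C" "t \<in> I \<inter> C" using near that by (auto simp: \<delta>_def)
      then have "\<bar>G s - G t\<bar> \<le> M * \<bar>s - t\<bar>" by (rule lip)
      also have "\<bar>s - t\<bar> < 2 * \<delta>"
        using that(3,4) abs_triangle_ineq4[of "s - c" "t - c"] by simp
      then have "M * \<bar>s - t\<bar> < M * (2 * \<delta>)" using \<open>M > 0\<close> by simp
      also have "\<dots> \<le> M * (2 * (\<epsilon> / (2 * M)))"
        using \<open>M > 0\<close> by (intro mult_left_mono) (auto simp: \<delta>_def)
      also have "\<dots> = \<epsilon>" using \<open>M > 0\<close> by simp
      finally show ?thesis .
    qed
    ultimately show "\<exists>\<delta>>0. \<forall>s\<in>I. \<forall>t\<in>I. \<bar>s - c\<bar> < \<delta> \<longrightarrow> \<bar>t - c\<bar> < \<delta> \<longrightarrow> \<bar>G s - G t\<bar> < \<epsilon>"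
      by blast
  qed
qed

section \<open>Boundary values of curves on the graph of a monotone \<open>H\<close>\<close>

lemma closure_point_approx:
  fixes x y :: "'a::metric_space \<Rightarrow> real"
  assumes "continuous_on (closure \<Omega>) x" "continuous_on (closure \<Omega>) y" "p \<in> closure \<Omega>" "r > 0"
  obtains q where "q \<in> \<Omega>" "\<bar>x q - x p\<bar> < r" "\<bar>y q - y p\<bar> < r"
proof -
  obtain a where a: "a > 0" "\<forall>q\<in>closure \<Omega>. dist q p < a \<longrightarrow> dist (x q) (x p) < r"
    using assms(1,3,4) unfolding continuous_on_iff by blast
  obtain b where b: "b > 0" "\<forall>q\<in>closure \<Omega>. dist q p < b \<longrightarrow> dist (y q) (y p) < r"
    using assms(2,3,4) unfolding continuous_on_iff by blast
  obtain q where "q \<in> \<Omega>" "dist q p < min a b"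
    using assms(3) a(1) b(1) unfolding closure_approachable by (metis min_less_iff_conj)
  with a(2) b(2) closure_subset[of \<Omega>] show ?thesis
    by (intro that[of q]) (auto simp: dist_real_def subset_iff)
qed

text \<open>At a frontier point \<open>y p\<close> may lie outside \<open>I\<close>, where
  \<open>H (y p)\<close> carries no information. What survives of \<open>x = H o y\<close> is a
  comparison with \<open>H\<close> at points of \<open>I\<close> on either side.\<close>

lemma antimono_closure_values:
  fixes x y :: "'a::metric_space \<Rightarrow> real"
  assumes cont: "continuous_on (closure \<Omega>) x" "continuous_on (closure \<Omega>) y" and p: "p \<in> closure \<Omega>"
    and x: "\<And>q. q \<in> \<Omega> \<Longrightarrow> x q = H (y q)" and y: "\<And>q. q \<in> \<Omega> \<Longrightarrow> y q \<in> I"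
    and H: "antimono_on I H" and t: "t \<in> I"
  shows "t < y p \<Longrightarrow> x p \<le> H t" and "y p < t \<Longrightarrow> H t \<le> x p"
proof -
  show "x p \<le> H t" if "t < y p"
  proof (rule ccontr)
    assume "\<not> x p \<le> H t"
    \<comment> \<open>The smaller of the two gaps as radius leaves \<open>y q\<close> above
      \<open>t\<close> and \<open>x q\<close> above \<open>H t\<close>, against
      monotonicity.\<close>
    then obtain q where q: "q \<in> \<Omega>" "\<bar>x q - x p\<bar> < min (x p - H t) (y p - t)"
      "\<bar>y q - y p\<bar> < min (x p - H t) (y p - t)"
      using closure_point_approx[OF cont p, of "min (x p - H t) (y p - t)"] \<open>t < y p\<close> by auto
    then have "t \<le> y q" "H t < x q" by linarith+
    then show False using monotone_onD[OF H t y[OF q(1)]] x[OF q(1)] by simp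
  qed
  show "H t \<le> x p" if "y p < t"
  proof (rule ccontr)
    assume "\<not> H t \<le> x p"
    then obtain q where q: "q \<in> \<Omega>" "\<bar>x q - x p\<bar> < min (H t - x p) (t - y p)"
      "\<bar>y q - y p\<bar> < min (H t - x p) (t - y p)"
      using closure_point_approx[OF cont p, of "min (H t - x p) (t - y p)"] \<open>y p < t\<close> by auto
    then have "y q \<le> t" "x q < H t" by linarith+
    then show False using monotone_onD[OF H y[OF q(1)] t] x[OF q(1)] by simp
  qed
qed

section \<open>Comparison of two harmonic curves with a common \<open>H\<close>\<close>

theorem proposition4p6:
  fixes \<Omega> :: "(real^'n) set" and f g :: "real^'n \<Rightarrow> heisenberg"
    and I :: "real set" and H :: "real \<Rightarrow> real"
  assumes domain: "open \<Omega>" "connected \<Omega>" "\<Omega> \<noteq> {}" "bounded \<Omega>"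
    and interval: "is_interval I" "\<exists>a\<in>I. \<exists>b\<in>I. a < b"
    and H_C3: "Ck_on_interval 3 I H"
    and f: "harmonic_curve \<Omega> f" "corresponds_to \<Omega> f I H" "continuous_on (closure \<Omega>) f"
    and g: "harmonic_curve \<Omega> g" "corresponds_to \<Omega> g I H" "continuous_on (closure \<Omega>) g"
    and H_ineq: "\<forall>s \<in> Y f ` \<Omega>.
      (deriv_within I ^^ 3) H s * deriv_within I H s * (1 + (deriv_within I H s)\<^sup>2)
      + ((deriv_within I ^^ 2) H s)\<^sup>2 * (1 - (deriv_within I H s)\<^sup>2) \<le> 0"
  shows "((\<forall>p\<in>frontier \<Omega>. Y f p \<le> Y g p) \<longrightarrow> (\<forall>p\<in>\<Omega>. Y f p \<le> Y g p)) \<and>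
    (antimono_on I H \<longrightarrow>
      (\<forall>p\<in>frontier \<Omega>. X f p \<le> X g p) \<longrightarrow> (\<forall>p\<in>\<Omega>. X f p \<le> X g p))"
proof -
  define h1 where "h1 = deriv_within I H"
  define h2 where "h2 = (deriv_within I ^^ 2) H"
  define h3 where "h3 = (deriv_within I ^^ 3) H"
  define Q where "Q s = h3 s * h1 s * (1 + (h1 s)\<^sup>2) + (h2 s)\<^sup>2 * (1 - (h1 s)\<^sup>2)" for s
  have H': "(H has_real_derivative h1 s) (at s within I)"
    and h1': "(h1 has_real_derivative h2 s) (at s within I)"
    and h2': "(h2 has_real_derivative h3 s) (at s within I)" if "s \<in> I" for s
    using Ck_on_interval_DERIV[OF H_C3 _ that, of 0] Ck_on_interval_DERIV[OF H_C3 _ that, of 1]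
      Ck_on_interval_DERIV[OF H_C3 _ that, of 2]
    by (simp_all add: h1_def h2_def h3_def numeral_2_eq_2 numeral_3_eq_3)
  note cont = DERIV_continuous_on[OF H'] DERIV_continuous_on[OF h1'] DERIV_continuous_on[OF h2']
  have h3: "continuous_on I h3"
    using H_C3 by (simp add: Ck_on_interval_def h3_def)
  have pos: "1 + (h1 s)\<^sup>2 > 0" for s by (simp add: add_pos_nonneg)
  let ?g = "\<lambda>s. sqrt (1 + (h1 s)\<^sup>2)"
  have "continuous_on I ?g" by (intro continuous_intros cont)
  then obtain G where G: "\<And>s. s \<in> I \<Longrightarrow> (G has_real_derivative ?g s) (at s within I)"
    using antiderivative_on_interval[OF interval(1)] by blast
  have G_mono: "strict_mono_on I G"
  proof (rule strict_mono_onI)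
    fix s t assume st: "s \<in> I" "t \<in> I" "s < t"
    then obtain z where "G t - G s = ?g z * (t - s)"
      using mvt_within_interval[OF interval(1) st(1,2) _ G] by (metis less_imp_le)
    moreover have "?g z * (t - s) > 0" using st(3) pos by simp
    ultimately show "G s < G t" by simp
  qed
  note arc = harmonic_curve_arc_length[OF domain(1) _ _ H' h1' cont(3) G]
  have rangef: "Y f p \<in> I" and rangeg: "Y g p \<in> I"
    and Xf: "X f p = H (Y f p)" and Xg: "X g p = H (Y g p)" if "p \<in> \<Omega>" for p
    using f(2) g(2) that by (auto simp: corresponds_to_def)
  have ccont: "continuous_on (closure \<Omega>) (X f)" "continuous_on (closure \<Omega>) (Y f)"
    "continuous_on (closure \<Omega>) (X g)" "continuous_on (closure \<Omega>) (Y g)"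
    unfolding X_def[abs_def] Y_def[abs_def] by (intro continuous_intros f(3) g(3))+
  \<comment> \<open>Boundary values of \<open>Y f\<close> lie in this closure, though possibly
    outside \<open>I\<close>.\<close>
  define C where "C = closure (Y f ` \<Omega>)"
  have YC: "Y f p \<in> C" if "p \<in> closure \<Omega>" for p
    using image_closure_subset[OF ccont(2) closed_closure closure_subset] that by (auto simp: C_def)
  have "is_interval C"
    unfolding C_def is_interval_connected_1
    using closure_subset[of \<Omega>] continuous_on_subset[OF ccont(2)] domain(2)
    by (intro connected_imp_connected_closure connected_continuous_image) auto
  have "bounded C"
  proof -
    have "compact (Y f ` closure \<Omega>)"
      using domain(4) by (intro compact_continuous_image ccont) simp
    moreover have "Y f ` \<Omega> \<subseteq> Y f ` closure \<Omega>" using closure_subset by blast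
    ultimately show ?thesis
      unfolding C_def by (meson bounded_closure bounded_subset compact_imp_bounded)
  qed
  define J where "J = I \<inter> C"
  have J: "is_interval J"
    unfolding J_def using interval(1) \<open>is_interval C\<close> by (rule is_interval_Int)
  have YJ: "Y f p \<in> J" if "p \<in> \<Omega>" for p
    using that rangef YC closure_subset by (auto simp: J_def)
  \<comment> \<open>The third derivative of \<open>H\<close> is continuous on \<open>I\<close>, so
    the inequality passes to limits of values of \<open>Y f\<close> that lie in
    \<open>I\<close>.\<close>
  have Q_J: "Q s \<le> 0" if "s \<in> J" for s
  proof -
    obtain x where x: "\<And>n. x n \<in> Y f ` \<Omega>" "x \<longlonglongrightarrow> s"
      using \<open>s \<in> J\<close> closure_sequential[of s "Y f ` \<Omega>"] by (auto simp: J_def C_def)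
    have "continuous_on I Q"
      unfolding Q_def[abs_def] by (intro continuous_intros cont h3)
    moreover have "x n \<in> I" for n
      using subsetD[OF _ x(1)[of n]] f(2) by (simp add: corresponds_to_def)
    ultimately have "(\<lambda>n. Q (x n)) \<longlonglongrightarrow> Q s"
      using x(2) \<open>s \<in> J\<close> by (intro continuous_on_tendsto_compose[of I Q]) (auto simp: J_def)
    moreover have "Q (x n) \<le> 0" for n
      using bspec[OF H_ineq x(1)[of n]] by (simp add: Q_def h1_def h2_def h3_def)
    ultimately show ?thesis by (intro LIMSEQ_le_const2) auto
  qed
  \<comment> \<open>\<open>L\<close> is the logarithm of the derivative of \<open>G\<close>, and
    \<open>A\<close> is the derivative of \<open>L\<close>. The derivative of \<open>A\<close> is
    \<open>Q / (1 + h1^2)^2\<close>, so \<open>L\<close> is concave on \<open>J\<close>.\<close>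
  define L where "L s = ln (1 + (h1 s)\<^sup>2) / 2" for s
  define A where "A s = h1 s * h2 s / (1 + (h1 s)\<^sup>2)" for s
  have tangent: "L s \<le> L s0 + A s0 * (s - s0)" if "s0 \<in> J" "s \<in> J" for s s0
  proof (rule concave_below_tangent[OF J that])
    fix t assume t: "t \<in> J"
    have h1J: "(h1 has_real_derivative h2 t) (at t within J)"
      and h2J: "(h2 has_real_derivative h3 t) (at t within J)"
      using t h1' h2' has_field_derivative_subset[of _ _ t I J] by (auto simp: J_def)
    have h1sq: "((\<lambda>s. 1 + (h1 s)\<^sup>2) has_real_derivative 2 * h1 t * h2 t) (at t within J)"
      by (auto intro!: derivative_eq_intros h1J)
    have "((\<lambda>s. ln (1 + (h1 s)\<^sup>2)) has_real_derivative 1 / (1 + (h1 t)\<^sup>2) * (2 * h1 t * h2 t))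
        (at t within J)"
      by (rule DERIV_chain2[OF DERIV_ln_divide[OF pos] h1sq])
    from DERIV_cdivide[OF this, of 2]
    have "((\<lambda>s. ln (1 + (h1 s)\<^sup>2) / 2) has_real_derivative h1 t * h2 t / (1 + (h1 t)\<^sup>2)) (at t within J)"
      by (rule DERIV_cong) (simp del: distrib_left_numeral distrib_right_numeral)
    then show "(L has_real_derivative A t) (at t within J)"
      unfolding L_def[abs_def] A_def .
    have "((\<lambda>s. h1 s * h2 s / (1 + (h1 s)\<^sup>2)) has_real_derivative
        ((h2 t * h2 t + h3 t * h1 t) * (1 + (h1 t)\<^sup>2) - h1 t * h2 t * (2 * h1 t * h2 t))
          / ((1 + (h1 t)\<^sup>2) * (1 + (h1 t)\<^sup>2))) (at t within J)"
      using pos[of t] by (intro DERIV_divide DERIV_mult h1J h2J h1sq) simp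
    moreover have "(h2 t * h2 t + h3 t * h1 t) * (1 + (h1 t)\<^sup>2) - h1 t * h2 t * (2 * h1 t * h2 t) = Q t"
      by (simp add: Q_def power2_eq_square algebra_simps)
    ultimately show "(A has_real_derivative Q t / ((1 + (h1 t)\<^sup>2) * (1 + (h1 t)\<^sup>2))) (at t within J)"
      unfolding A_def[abs_def] by simp
    show "Q t / ((1 + (h1 t)\<^sup>2) * (1 + (h1 t)\<^sup>2)) \<le> 0"
      using Q_J[OF t] pos[of t] by (simp add: divide_nonpos_pos)
  qed
  obtain p1 where p1: "p1 \<in> \<Omega>" using domain(3) by blast
  \<comment> \<open>This makes equality of boundary values admissible in
    \<open>comparison_principle\<close>, also at an end point missing from \<open>I\<close>.\<close>
  have Cauchy: "Cauchy_within I G c" if "c \<in> C" for c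
  proof (rule Cauchy_within_if_log_concave[OF interval(1) \<open>is_interval C\<close> \<open>bounded C\<close> G])
    show "ln (?g s) \<le> ln (?g s0) + A s0 * (s - s0)" if "s \<in> I \<inter> C" "s0 \<in> I \<inter> C" for s s0
      using tangent[of s0 s] that pos by (simp add: J_def L_def ln_sqrt)
    show "Y f p1 \<in> I \<inter> C" using YJ[OF p1] by (simp add: J_def)
  qed (use pos that in auto)
  show ?thesis
  proof (intro conjI impI ballI)
    fix q assume bd: "\<forall>p\<in>frontier \<Omega>. Y f p \<le> Y g p" and q: "q \<in> \<Omega>"
    show "Y f q \<le> Y g q"
    proof (rule comparison_principle[OF domain(1,4) ccont(2,4) _ _ G_mono
        arc(1)[OF f(1,2)] arc(1)[OF g(1,2)] arc(2)[OF f(1,2)] arc(2)[OF g(1,2)] _ q])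
      show "Y f p < Y g p \<or> Y f p = Y g p \<and> Cauchy_within I G (Y f p)" if "p \<in> frontier \<Omega>" for p
        using bd that Cauchy[OF YC] by (force simp: frontier_def)
    qed (use rangef rangeg in auto)
  next
    fix q assume anti: "antimono_on I H" and bd: "\<forall>p\<in>frontier \<Omega>. X f p \<le> X g p" and q: "q \<in> \<Omega>"
    have limf: "H t \<le> X f p" if "p \<in> closure \<Omega>" "t \<in> I" "Y f p < t" for p t
      using antimono_closure_values(2)[OF ccont(1,2) that(1) Xf rangef anti that(2,3)] .
    have limg: "X g p \<le> H t" if "p \<in> closure \<Omega>" "t \<in> I" "t < Y g p" for p t
      using antimono_closure_values(1)[OF ccont(3,4) that(1) Xg rangeg anti that(2,3)] .
    show "X f q \<le> X g q"
    proof (cases "\<exists>s0\<in>J. h1 s0 = 0")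
      case True
      then obtain s0 where s0: "s0 \<in> J" "h1 s0 = 0" by blast
      have h1_0: "h1 s = 0" if "s \<in> J" for s
      proof -
        \<comment> \<open>\<open>L s0\<close> and \<open>A s0\<close> both vanish with
          \<open>h1 s0\<close>, so the tangent is the zero line.\<close>
        have "ln (1 + (h1 s)\<^sup>2) \<le> 0"
          using tangent[OF s0(1) that] s0(2) by (simp add: L_def A_def)
        then have "(h1 s)\<^sup>2 \<le> 0" using pos[of s] by (simp add: ln_le_zero_iff)
        then show ?thesis by simp
      qed
      have H_J: "H s = H t" if "s \<in> J" "t \<in> J" for s t
      proof -
        have "(H has_real_derivative 0) (at z within J)" if "z \<in> J" for z
          using H'[of z] h1_0[OF that] that has_field_derivative_subset[of H _ z I J]
          by (auto simp: J_def)
        from has_field_derivative_zero_constant[OF is_interval_convex[OF J] this]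
        show ?thesis using that by metis
      qed
      have Xf_const: "X f p = X f q" if "p \<in> closure \<Omega>" for p
      proof (rule continuous_constant_on_closure[OF ccont(1) _ that])
        show "X f p = X f q" if "p \<in> \<Omega>" for p
          using H_J[OF YJ[OF that] YJ[OF q]] by (simp add: Xf that q)
      qed
      show ?thesis
      proof (rule ccontr)
        assume "\<not> X f q \<le> X g q"
        then have less: "H (Y g q) < H (Y f q)" by (simp add: Xf Xg q)
        have le: "Y f q \<le> Y g q"
          using monotone_onD[OF anti rangeg[OF q] rangef[OF q]] less by linarith
        note sub = real_interval_subset[OF interval(1) rangef[OF q] rangeg[OF q]]
        \<comment> \<open>With \<open>H m\<close> halfway, \<open>Y g p > m\<close> on the frontier
          would give \<open>X g p \<le> H m < X f q = X f p\<close>. So \<open>Y g\<close> is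
          compared with the constant \<open>m\<close>, although \<open>m < Y g q\<close>.\<close>
        obtain m where m: "Y f q \<le> m" "m \<le> Y g q" "H m = (H (Y g q) + H (Y f q)) / 2"
          using IVT2'[of H "Y g q" "(H (Y g q) + H (Y f q)) / 2" "Y f q"] le less
            continuous_on_subset[OF cont(1) sub] by auto
        then have "m \<in> I" and "m < Y g q"
          using sub less by (auto simp: less_le)
        have "Y g q \<le> m"
        proof (rule comparison_principle[OF domain(1,4) ccont(4) _ _ _ G_mono
            arc(1)[OF g(1,2)] Ck_on_const arc(2)[OF g(1,2)] _ _ q])
          fix p assume "p \<in> frontier \<Omega>"
          then have p: "p \<in> closure \<Omega>" "X f p \<le> X g p" using bd by (auto simp: frontier_def)
          have "Y g p \<le> m"
          proof (rule ccontr)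
            assume "\<not> Y g p \<le> m"
            then have "X g p \<le> H m" using limg[OF p(1) \<open>m \<in> I\<close>] by simp
            then show False using p(2) Xf_const[OF p(1)] m(3) less by (simp add: Xf[OF q])
          qed
          moreover have "Cauchy_within I G m"
            using Cauchy_within_if_continuous[OF DERIV_continuous_on[OF G] \<open>m \<in> I\<close>] .
          ultimately show "Y g p < m \<or> Y g p = m \<and> Cauchy_within I G (Y g p)" by auto
        qed (use rangeg \<open>m \<in> I\<close> in \<open>auto simp: laplacian_def\<close>)
        with \<open>m < Y g q\<close> show False by simp
      qed
    next
      case False
      \<comment> \<open>Otherwise \<open>H\<close> is constant between \<open>Y f p\<close> and
        \<open>Y g p\<close>, so \<open>h1\<close> vanishes there; this interval is then shown to
        meet \<open>J\<close> or to end at a point of \<open>J\<close>.\<close>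
      have le: "Y g p \<le> Y f p" if p: "p \<in> frontier \<Omega>" for p
      proof (rule ccontr)
        assume "\<not> Y g p \<le> Y f p"
        then have less: "Y f p < Y g p" by simp
        have p': "p \<in> closure \<Omega>" using p by (simp add: frontier_def)
        have in_I: "t \<in> I" if t: "Y f p < t" "t < Y g p" for t
        proof -
          obtain q1 where "q1 \<in> \<Omega>" "\<bar>Y f q1 - Y f p\<bar> < t - Y f p"
            using closure_point_approx[OF ccont(2,2) p', of "t - Y f p"] t by auto
          moreover obtain q2 where "q2 \<in> \<Omega>" "\<bar>Y g q2 - Y g p\<bar> < Y g p - t"
            using closure_point_approx[OF ccont(4,4) p', of "Y g p - t"] t by auto
          ultimately show ?thesis
            using mem_is_interval_1_I[OF interval(1) rangef[of q1] rangeg[of q2], of t]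
            by (simp add: abs_less_iff)
        qed
        \<comment> \<open>\<open>limg\<close>, \<open>limf\<close> and the boundary inequality
          squeeze \<open>H t\<close> by
          \<open>X g p \<le> H t \<le> X f p \<le> X g p\<close>.\<close>
        have H_const: "H t = X f p" if t: "t \<in> {Y f p<..<Y g p}" for t
          using limf[OF p', of t] limg[OF p', of t] in_I[of t] bd p t by fastforce
        have h1_0: "h1 t = 0" if t: "Y f p < t" "t < Y g p" for t
        proof -
          have "(H has_real_derivative h1 t) (at t within {Y f p<..<Y g p})"
            by (rule has_field_derivative_subset[OF H'[OF in_I[OF t]]]) (use in_I in auto)
          moreover have "at t within {Y f p<..<Y g p} = at t"
            by (rule at_within_open) (use t in auto)
          ultimately have "(H has_real_derivative h1 t) (at t)" by simp
          moreover have "(H has_real_derivative 0) (at t)"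
            by (rule has_field_derivative_transform_within_open[where f = "\<lambda>_. X f p"
                and S = "{Y f p<..<Y g p}"]) (use t H_const in auto)
          ultimately show ?thesis by (rule DERIV_unique)
        qed
        show False
        proof (cases "Y f p \<in> I")
          case True
          then have "h1 (Y f p) \<noteq> 0" using False YC[OF p'] by (auto simp: J_def)
          \<comment> \<open>Closer than \<open>d\<close>, \<open>h1\<close> stays nonzero by
            continuity, yet it vanishes immediately to the right of \<open>Y f p\<close>.\<close>
          then obtain d where d: "d > 0"
            "\<forall>t\<in>I. dist t (Y f p) < d \<longrightarrow> dist (h1 t) (h1 (Y f p)) < \<bar>h1 (Y f p)\<bar>"
            using cont(2) True unfolding continuous_on_iff by (metis zero_less_abs_iff)
          obtain t where t: "Y f p < t" "t < min (Y f p + d) (Y g p)"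
            using dense[of "Y f p" "min (Y f p + d) (Y g p)"] d(1) less by auto
          then have "dist (h1 t) (h1 (Y f p)) < \<bar>h1 (Y f p)\<bar>"
            using d(2) in_I[of t] by (auto simp: dist_real_def)
          then show False using h1_0[of t] t by (simp add: dist_real_def)
        next
          case notI: False
          \<comment> \<open>\<open>Y f p\<close> is a left end point missing from \<open>I\<close>,
            so nearby values of \<open>Y f\<close> exceed it and fall into the interval where
            \<open>h1\<close> vanishes.\<close>
          obtain q1 where q1: "q1 \<in> \<Omega>" "\<bar>Y f q1 - Y f p\<bar> < Y g p - Y f p"
            using closure_point_approx[OF ccont(2,2) p', of "Y g p - Y f p"] less by auto
          have "Y f p < Y f q1"
          proof (rule ccontr)
            assume "\<not> Y f p < Y f q1"
            obtain t where "Y f p < t" "t < Y g p" using dense[OF less] by blast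
            then show False
              using mem_is_interval_1_I[OF interval(1) rangef[OF q1(1)] in_I[of t], of "Y f p"]
                notI \<open>\<not> Y f p < Y f q1\<close> by simp
          qed
          then have "h1 (Y f q1) = 0" using q1(2) by (intro h1_0) auto
          then show False using False YJ[OF q1(1)] by blast
        qed
      qed
      \<comment> \<open>The roles of the curves are exchanged. Where their boundary values agree,
        the common value lies in \<open>C\<close>, so \<open>Cauchy\<close> still applies.\<close>
      have "Y g q \<le> Y f q"
      proof (rule comparison_principle[OF domain(1,4) ccont(4,2) _ _ G_mono
          arc(1)[OF g(1,2)] arc(1)[OF f(1,2)] arc(2)[OF g(1,2)] arc(2)[OF f(1,2)] _ q])
        show "Y g p < Y f p \<or> Y g p = Y f p \<and> Cauchy_within I G (Y g p)" if "p \<in> frontier \<Omega>" for p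
          using le[OF that] that Cauchy[OF YC[of p]] by (force simp: frontier_def)
      qed (use rangef rangeg in auto)
      then show ?thesis
        using monotone_onD[OF anti rangeg[OF q] rangef[OF q]] by (simp add: Xf Xg q)
    qed
  qed
qed

end
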